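(* Let $\varphi=\frac{\sqrt5-1}{2}=[0;\overline{1}]$, $\mu_{\max}=1+\varphi$ and $\mu_{\min}=1+\varphi^2$. Let $\mathbf{x}$ be a Sturmian word of slope $\varphi$. Then $\mu_{\min}\le\operatorname{rep}(\mathbf{x})\le\mu_{\max}$. Moreover: - $\operatorname{rep}(\mathbf{x})=\mu_{\max}$ if and only if the locating chain of $\mathbf{x}$ is $u\overline{a}$ for some finite word $u$ or $v\overline{b}$ for some finite word $v$; - $\operatorname{rep}(\mathbf{x})=\mu_{\min}$ if and only if $\mathbf{x}\in S_d$ for every $d\ge1$.
   Context: Sturmian words: for an irrational $\theta\in(0,1)$, a Sturmian word of slope $\theta$ is an infinite word $\mathbf{x}=x_1x_2\dots$ over $\{0,1\}$ for which there is a real $\rho$ such that either $x_n=\lfloor (n+1)\theta+\rho\rfloor-\lfloor n\theta+\rho\rfloor$ for all $n\ge1$, or $x_n=\lceil (n+1)\theta+\rho\rceil-\lceil n\theta+\rho\rceil$ for all $n\ge1$. Exponent of repetition: $r(n,\mathbf{x})=\min\{m : x_j\dots x_{j+n-1}=x_{m-n+1}\dots x_m\text{ for some }1\le j\le m-n\}$ and $\operatorname{rep}(\mathbf{x})=\liminf_{n\to\infty} r(n,\mathbf{x})/n$. Locating chain (slope $\varphi$): let $M_0=0$, $M_1=1$ and $M_{k+1}=M_kM_{k-1}$ for $k\ge1$ (concatenation of words). For $k\ge1$, let $\widetilde{M}_k$ be the word $M_kM_{k-1}$ with its last two letters deleted. It is known that for a Sturmian word $\mathbf{x}$ of slope $\varphi$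 and each $k\ge1$ there is a unique finite word $W_k$ satisfying one of the following, and exactly one of the three cases holds: (i) $\mathbf{x}=W_kM_k\widetilde{M}_k\dots$ with $W_k$ a non-empty suffix of $M_k$; (ii) $\mathbf{x}=W_kM_{k-1}M_k\widetilde{M}_k\dots$ with $W_k$ a non-empty suffix of $M_k$; (iii) $\mathbf{x}=W_kM_k\widetilde{M}_k\dots$ with $W_k$ a non-empty suffix of $M_{k-1}$. The locating chain of $\mathbf{x}$ is the infinite sequence over the symbols (i), (ii), (iii) whose $k$-th term ($k\ge1$) is the case to which $\mathbf{x}$ belongs at level $k$. For slope $\varphi$ each (i) is immediately followed by (iii), and (apart from a possible first symbol (iii)) each (iii) is immediately preceded by (i). Write $a$ for the block (i)(iii) and $b$ for the symbol (ii); thus the locating chain is an infinite word in $a,b$, possibly preceded by one symbol (iii). Finite words $u,v$ are words in the symbols (i), (ii), (iii), and $\overline{w}$ denotes $www\cdots$. The sets $S_d$: an $a$-chain is a maximal block $aa\cdots a$ in the locating chain with a $b$ immediately before and immediately after it; a $b$-chain is a maximal block $bb\cdots b$ with an $a$ immediately before and immediately after it. The length of a chain is its number of letters $a$ (respectively $b$). For $d\ge1$, $S_d$ is the set of Sturmian words $\mathbf{x}$ of slope $\varphi$ whose locating chain contains infinitely many $a$-chains of length $\ge d$ or infinitely many $b$-chains of length $\ge d$ (counted as occurrences). *)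

theory Defs
  imports Complex_Main "HOL-Library.Stream" "HOL-Library.Sublist" "HOL-Library.Extended_Real"
begin

text \<open>An infinite word \<open>x\<^sub>1 x\<^sub>2 x\<^sub>3 \<dots>\<close> is a stream, so the letter \<open>x\<^sub>n\<close> (with \<open>n \<ge> 1\<close>) is
  \<open>x !! (n - 1)\<close>. The letters \<open>0\<close>, \<open>1\<close> are integers.\<close>

definition sturmian :: "real \<Rightarrow> int stream \<Rightarrow> bool" where
  "sturmian \<theta> x \<longleftrightarrow> 0 < \<theta> \<and> \<theta> < 1 \<and> \<theta> \<notin> \<rat> \<and>
     (\<exists>\<rho>::real.
        (\<forall>n\<ge>1. x !! (n - 1) = \<lfloor>real (n + 1) * \<theta> + \<rho>\<rfloor> - \<lfloor>real n * \<theta> + \<rho>\<rfloor>) \<or>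
        (\<forall>n\<ge>1. x !! (n - 1) = \<lceil>real (n + 1) * \<theta> + \<rho>\<rceil> - \<lceil>real n * \<theta> + \<rho>\<rceil>))"

text \<open>The factor of length \<open>n\<close> starting at the letter \<open>x\<^sub>j\<close>, for \<open>j \<ge> 1\<close>.\<close>

definition factor :: "'a stream \<Rightarrow> nat \<Rightarrow> nat \<Rightarrow> 'a list" where
  "factor x j n = stake n (sdrop (j - 1) x)"

definition repetition :: "nat \<Rightarrow> 'a stream \<Rightarrow> nat" where
  "repetition n x =
     (LEAST m. \<exists>j. 1 \<le> j \<and> j \<le> m - n \<and> factor x j n = factor x (m - n + 1) n)"

definition rep :: "'a stream \<Rightarrow> ereal" where
  "rep x = liminf (\<lambda>n. ereal (real (repetition n x) / real n))"

definition golden_slope :: real where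
  "golden_slope = (sqrt 5 - 1) / 2"

definition mu_max :: real where
  "mu_max = 1 + golden_slope"

definition mu_min :: real where
  "mu_min = 1 + golden_slope ^ 2"

fun M :: "nat \<Rightarrow> int list" where
  "M 0 = [0]"
| "M (Suc 0) = [1]"
| "M (Suc (Suc k)) = M (Suc k) @ M k"

definition M_tilde :: "nat \<Rightarrow> int list" where
  "M_tilde k = butlast (butlast (M k @ M (k - 1)))"

datatype symbol = Case_i | Case_ii | Case_iii

fun in_case :: "int stream \<Rightarrow> nat \<Rightarrow> symbol \<Rightarrow> bool" where
  "in_case x k Case_i \<longleftrightarrow>
     (\<exists>W y. W \<noteq> [] \<and> suffix W (M k) \<and> x = (W @ M k @ M_tilde k) @- y)"
| "in_case x k Case_ii \<longleftrightarrow>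
     (\<exists>W y. W \<noteq> [] \<and> suffix W (M k) \<and> x = (W @ M (k - 1) @ M k @ M_tilde k) @- y)"
| "in_case x k Case_iii \<longleftrightarrow>
     (\<exists>W y. W \<noteq> [] \<and> suffix W (M (k - 1)) \<and> x = (W @ M k @ M_tilde k) @- y)"

text \<open>Exactly one case applies at each level \<open>k \<ge> 1\<close> when \<open>x\<close> is Sturmian of slope
  \<open>golden_slope\<close>; the description operator is not meaningful for other words. The chain
  starts with level \<open>1\<close>.\<close>

definition locating_chain :: "int stream \<Rightarrow> symbol stream" where
  "locating_chain x = smap (\<lambda>k. THE c. in_case x k c) (fromN 1)"

definition block_a :: "symbol list" where
  "block_a = [Case_i, Case_iii]"

definition block_b :: "symbol list" where
  "block_b = [Case_ii]"

text \<open>A run of one block delimited on both sides by the other block is automatically maximal.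
  Chains are located by the position, counted in the symbols (i), (ii), (iii), of the delimiter
  on the left, so distinct occurrences have distinct positions.\<close>

definition a_chain_at :: "symbol stream \<Rightarrow> nat \<Rightarrow> nat \<Rightarrow> bool" where
  "a_chain_at c p l \<longleftrightarrow> l \<ge> 1 \<and>
     (\<exists>y. sdrop p c = (block_b @ concat (replicate l block_a) @ block_b) @- y)"

definition b_chain_at :: "symbol stream \<Rightarrow> nat \<Rightarrow> nat \<Rightarrow> bool" where
  "b_chain_at c p l \<longleftrightarrow> l \<ge> 1 \<and>
     (\<exists>y. sdrop p c = (block_a @ concat (replicate l block_b) @ block_a) @- y)"

definition S :: "nat \<Rightarrow> int stream set" where
  "S d = {x. sturmian golden_slope x \<and>
     (infinite {p. \<exists>l\<ge>d. a_chain_at (locating_chain x) p l} \<or>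
      infinite {p. \<exists>l\<ge>d. b_chain_at (locating_chain x) p l})}"

end

theory Submission
  imports Defs "HOL-Number_Theory.Fib"
begin


text \<open>
  A Sturmian word of slope \<open>\<phi>\<close> has every window sum within distance \<open>1\<close> of \<open>m\<phi>\<close>, a property that
  survives the inverse of the substitution \<open>1 \<mapsto> 10\<close>, \<open>0 \<mapsto> 1\<close>. Iterating it factors the word at
  every level into blocks \<open>M\<^sub>k\<^sub>+\<^sub>1\<close> and \<open>M\<^sub>k\<close> behind a partial first block \<open>W\<close>, and the first two blocks
  tell the symbol of the locating chain. Going up a level changes the length of \<open>W\<close> only at a
  symbol (ii), so the chain determines these lengths.

  If a factor of length \<open>n\<close> recurs at distance \<open>p\<close>, where \<open>p\<close> is less than a Fibonacci number which is at most
  \<open>n + 1\<close>, then \<open>p\<close> is the preceding Fibonacci number. As \<open>M\<^sub>k M\<^sub>k\<^sub>+\<^sub>1\<close> and \<open>M\<^sub>k\<^sub>+\<^sub>1 M\<^sub>k\<close> differ exactly in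
  their last two letters, a repetition with shift \<open>|M\<^sub>k|\<close> stops near the end of every block \<open>M\<^sub>k\<^sub>+\<^sub>1\<close>.
  Hence, up to bounded errors, the early repetitions are governed by \<open>|W|\<close> at the symbols (ii) and (iii),
  and the value \<open>1 + \<phi>\<^sup>2\<close> requires \<open>|W|\<close> to be relatively small at a (ii), as after a long
  \<open>a\<close>-chain, or relatively large at a (iii), as after a long \<open>b\<close>-chain.
\<close>

section \<open>Balanced words of golden slope\<close>

definition ones :: "int stream \<Rightarrow> nat \<Rightarrow> nat \<Rightarrow> int" where
  "ones z j m = (\<Sum>i<m. z !! (j + i))"

text \<open>No intercept appears here, so the condition passes to tails and to desubstituted words
  without tracking how \<open>\<rho>\<close> changes, and it treats floors and ceilings
  alike.\<close>

definition golden :: "int stream \<Rightarrow> bool" where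
  "golden z \<longleftrightarrow> (\<forall>j m. \<bar>real_of_int (ones z j m) - real m * golden_slope\<bar> < 1)"

lemma golden_slope_square: "golden_slope ^ 2 = 1 - golden_slope"
proof -
  have "(sqrt 5)^2 = (5::real)" by simp
  then show ?thesis unfolding golden_slope_def by (simp add: power2_eq_square field_simps)
qed

lemma golden_slope_bounds: "3/5 < golden_slope" "golden_slope < 2/3"
proof -
  have "(11/5::real) < sqrt 5" by (rule real_less_rsqrt) (simp add: power2_eq_square)
  moreover have "sqrt 5 < (7/3::real)" by (rule real_less_lsqrt) (simp_all add: power2_eq_square)
  ultimately show "3/5 < golden_slope" "golden_slope < 2/3" unfolding golden_slope_def by auto
qed

lemma ones_0 [simp]: "ones z j 0 = 0"
  by (simp add: ones_def)

lemma ones_add: "ones z j (m + n) = ones z j m + ones z (j + m) n"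
  by (induction n) (simp_all add: ones_def add.assoc)

lemma ones_Suc_0 [simp]: "ones z j (Suc 0) = z !! j"
  by (simp add: ones_def)

lemma ones_sdrop: "ones (sdrop s z) j m = ones z (s + j) m"
  by (simp add: ones_def sdrop_snth add.assoc)

lemma ones_stl: "ones (stl z) j m = ones z (Suc j) m"
  using ones_sdrop[of 1 z j m] by simp

lemma ones_SCons: "ones (a ## z) 0 (Suc m) = a + ones z 0 m"
  using ones_add[of "a ## z" 0 1 m] ones_stl[of "a ## z" 0 m] by simp

lemma golden_sdrop: "golden z \<Longrightarrow> golden (sdrop s z)"
  by (simp add: golden_def ones_sdrop)

lemma golden_stl: "golden z \<Longrightarrow> golden (stl z)"
  using golden_sdrop[of z 1] by simp

lemma goldenD: "golden z \<Longrightarrow> \<bar>real_of_int (ones z j m) - real m * golden_slope\<bar> < 1"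
  by (simp add: golden_def)

lemma golden_letter:
  assumes "golden z" shows "z !! j = 0 \<or> z !! j = 1"
proof -
  have "\<bar>real_of_int (z !! j) - golden_slope\<bar> < 1" using goldenD[OF assms, of j 1] by simp
  then have "real_of_int (z !! j) < 2" "real_of_int (z !! j) > -1"
    using golden_slope_bounds by linarith+
  then show ?thesis by linarith
qed

lemma golden_shd: "golden z \<Longrightarrow> shd z = 0 \<or> shd z = 1"
  using golden_letter[of z 0] by simp

lemma golden_after_0:
  assumes "golden z" "z !! j = 0" shows "z !! Suc j = 1"
proof -
  have "ones z j 2 = z !! j + z !! Suc j"
    using ones_add[of z j 1 1] by (simp add: numeral_2_eq_2)
  then have "\<bar>real_of_int (z !! Suc j) - 2 * golden_slope\<bar> < 1"
    using goldenD[OF assms(1), of j 2] assms(2) by simp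
  then have "real_of_int (z !! Suc j) > 0"
    using golden_slope_bounds by linarith
  then show ?thesis using golden_letter[OF assms(1), of "Suc j"] by auto
qed

text \<open>The count telescopes to a difference of two floors or two ceilings, which is less than 1
  away from the difference of the arguments.\<close>

lemma sturmian_imp_golden:
  assumes "sturmian golden_slope x" shows "golden x"
proof -
  obtain \<rho> where \<rho>:
    "(\<forall>n\<ge>1. x !! (n - 1) = \<lfloor>real (n + 1) * golden_slope + \<rho>\<rfloor> - \<lfloor>real n * golden_slope + \<rho>\<rfloor>) \<or>
     (\<forall>n\<ge>1. x !! (n - 1) = \<lceil>real (n + 1) * golden_slope + \<rho>\<rceil> - \<lceil>real n * golden_slope + \<rho>\<rceil>)"
    using assms unfolding sturmian_def by auto
  have "\<bar>real_of_int (ones x j m) - real m * golden_slope\<bar> < 1" for j m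
    using \<rho>
  proof
    assume h: "\<forall>n\<ge>1. x !! (n - 1) = \<lfloor>real (n + 1) * golden_slope + \<rho>\<rfloor> - \<lfloor>real n * golden_slope + \<rho>\<rfloor>"
    have "ones x j m = \<lfloor>real (j + m + 1) * golden_slope + \<rho>\<rfloor> - \<lfloor>real (j + 1) * golden_slope + \<rho>\<rfloor>"
    proof (induction m)
      case (Suc m)
      then show ?case using h[rule_format, of "j + m + 1"] by (simp add: ones_def algebra_simps)
    qed simp
    then show ?thesis by (simp add: algebra_simps) linarith
  next
    assume h: "\<forall>n\<ge>1. x !! (n - 1) = \<lceil>real (n + 1) * golden_slope + \<rho>\<rceil> - \<lceil>real n * golden_slope + \<rho>\<rceil>"
    have "ones x j m = \<lceil>real (j + m + 1) * golden_slope + \<rho>\<rceil> - \<lceil>real (j + 1) * golden_slope + \<rho>\<rceil>"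
    proof (induction m)
      case (Suc m)
      then show ?case using h[rule_format, of "j + m + 1"] by (simp add: ones_def algebra_simps)
    qed simp
    then show ?thesis by (simp add: algebra_simps) linarith
  qed
  then show ?thesis unfolding golden_def by blast
qed

text \<open>Only prefixes are new windows. The added 1 could make a prefix too heavy, but the 0
  behind it compensates because 2\<phi> > 1. This serves to complete a level that starts with 0 to
  one that starts with 10.\<close>

lemma golden_SCons_1:
  assumes "golden z" "shd z = 0" shows "golden (1 ## z)"
  unfolding golden_def
proof (intro allI)
  fix j m
  show "\<bar>real_of_int (ones (1 ## z) j m) - real m * golden_slope\<bar> < 1"
  proof (cases j)
    case (Suc j')
    then show ?thesis using ones_stl[of "1 ## z" j' m] goldenD[OF assms(1), of j' m] by simp
  next
    case 0
    show ?thesis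
    proof (cases m)
      case (Suc n)
      have eq: "ones (1 ## z) j m = 1 + ones z 0 n" using 0 Suc ones_SCons by simp
      have lo: "real_of_int (ones z 0 n) > real n * golden_slope - 1"
        using goldenD[OF assms(1), of 0 n] by linarith
      have up: "real_of_int (ones z 0 n) < (real n + 1) * golden_slope"
      proof (cases n)
        case 0 then show ?thesis using golden_slope_bounds by simp
      next
        case (Suc l)
        have "ones z 0 n = ones z 1 l" using ones_add[of z 0 1 l] assms(2) Suc by simp
        then have "real_of_int (ones z 0 n) < real l * golden_slope + 1"
          using goldenD[OF assms(1), of 1 l] by linarith
        then show ?thesis using Suc golden_slope_bounds by (simp add: algebra_simps)
      qed
      show ?thesis unfolding eq using lo up Suc golden_slope_bounds by (simp add: algebra_simps abs_less_iff)
    qed simp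
  qed
qed

section \<open>Desubstitution\<close>

text \<open>Inverse of the substitution \<open>1 \<mapsto> 10\<close>, \<open>0 \<mapsto> 1\<close>, for words that start with \<open>1\<close> and do not
  contain \<open>00\<close>.\<close>

primcorec desub :: "int stream \<Rightarrow> int stream" where
  "desub z = (if shd (stl z) = 0 then 1 ## desub (stl (stl z)) else 0 ## desub (stl z))"

lemma desub_simps:
  "shd (stl z) = 0 \<Longrightarrow> desub z = 1 ## desub (stl (stl z))"
  "shd (stl z) \<noteq> 0 \<Longrightarrow> desub z = 0 ## desub (stl z)"
  by (subst desub.code, simp)+

lemma golden_desub_cases:
  assumes "golden z" "shd z = 1"
  obtains (ten) z' where "z = 1 ## 0 ## z'" "golden z'" "shd z' = 1" "desub z = 1 ## desub z'"
        | (one) z' where "z = 1 ## z'" "golden z'" "shd z' = 1" "desub z = 0 ## desub z'"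
proof (cases "shd (stl z) = 0")
  case True
  have "z = 1 ## 0 ## stl (stl z)" using assms True by (metis stream.collapse)
  moreover have "shd (stl (stl z)) = 1" using golden_after_0[OF assms(1), of 1] True by simp
  ultimately show ?thesis
    using ten[of "stl (stl z)"] golden_stl[OF golden_stl[OF assms(1)]] desub_simps(1)[OF True] by simp
next
  case False
  have "z = 1 ## stl z" using assms by (metis stream.collapse)
  moreover have "shd (stl z) = 1" using golden_shd[OF golden_stl[OF assms(1)]] False by simp
  ultimately show ?thesis
    using one[of "stl z"] golden_stl[OF assms(1)] desub_simps(2)[OF False] by simp
qed

text \<open>The first \<open>m\<close> letters of \<open>desub z\<close> stand for the first
  \<open>L\<close> letters of \<open>z\<close>. Each of the blocks 10 and 1 holds exactly one 1, and
  only 10, which becomes the letter 1, has a second letter. At \<open>L\<close> the next block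
  begins.\<close>

lemma desub_prefix_count:
  assumes "golden z" "shd z = 1"
  shows "\<exists>L. int L = int m + ones (desub z) 0 m \<and> ones z 0 L = int m \<and> z !! L = 1"
  using assms
proof (induction m arbitrary: z)
  case 0
  then show ?case by (intro exI[of _ 0]) simp
next
  case (Suc m)
  from Suc.prems show ?case
  proof (cases rule: golden_desub_cases)
    case (ten z')
    then obtain L where L: "int L = int m + ones (desub z') 0 m" "ones z' 0 L = int m" "z' !! L = 1"
      using Suc.IH by blast
    show ?thesis
      by (intro exI[of _ "Suc (Suc L)"])
        (use L in \<open>simp add: ten(1) ten(4)[unfolded ten(1)] ones_SCons\<close>)
  next
    case (one z')
    then obtain L where L: "int L = int m + ones (desub z') 0 m" "ones z' 0 L = int m" "z' !! L = 1"
      using Suc.IH by blast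
    show ?thesis
      by (intro exI[of _ "Suc L"])
        (use L in \<open>simp add: one(1) one(4)[unfolded one(1)] ones_SCons\<close>)
  qed
qed

lemma desub_sdrop:
  assumes "golden z" "shd z = 1"
  shows "\<exists>z'. golden z' \<and> shd z' = 1 \<and> sdrop j (desub z) = desub z'"
  using assms
proof (induction j arbitrary: z)
  case 0 then show ?case by auto
next
  case (Suc j)
  from Suc.prems show ?case
    by (cases rule: golden_desub_cases) (use Suc.IH in auto)
qed

lemma golden_desub:
  assumes "golden z" "shd z = 1" shows "golden (desub z)"
proof -
  have *: "\<bar>real_of_int (ones (desub z) 0 m) - real m * golden_slope\<bar> < 1"
    if z: "golden z" "shd z = 1" for z m
  proof (cases m)
    case 0 then show ?thesis by simp
  next
    case (Suc l)
    obtain L where L: "int L = int m + ones (desub z) 0 m" "ones z 0 L = int m" "z !! L = 1"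
      using desub_prefix_count[OF z] by blast
    have "L > 0" using L(2) Suc by (cases L) auto
    then obtain L' where L': "L = Suc L'" by (cases L) auto
    define s where "s = real_of_int (ones (desub z) 0 m)"
    have Ls: "real L = real m + s" using L(1) unfolding s_def by linarith
    \<comment> \<open>Sharp bounds come from the heaviest and lightest windows that belong to the
      \<open>m\<close> blocks: the prefix extended by the 1 at \<open>L\<close> here, and the prefix
      without its initial 1 below. With \<phi>^2 = 1 - \<phi> both become \<phi> times the wanted
      inequality.\<close>
    have "ones z 0 (Suc L) = int m + 1" using ones_add[of z 0 L 1] L by simp
    then have "real m + 1 - real (Suc L) * golden_slope < 1" using goldenD[OF z(1), of 0 "Suc L"] by simp
    then have "real m * (1 - golden_slope) - s * golden_slope < golden_slope"
      using Ls by (simp add: algebra_simps)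
    then have "golden_slope * (real m * golden_slope - s) < golden_slope * 1"
      using arg_cong[OF golden_slope_square, of "\<lambda>t. real m * t"] by (simp add: algebra_simps power2_eq_square)
    then have 1: "real m * golden_slope - s < 1"
      using golden_slope_bounds by (subst (asm) mult_less_cancel_left_pos) auto
    have "ones z 1 L' = int m - 1"
      using ones_add[of z 0 1 L'] L L' z(2) by simp
    then have "real m - 1 - (real L - 1) * golden_slope > -1" using goldenD[OF z(1), of 1 L'] L' by simp
    then have "real m * (1 - golden_slope) - s * golden_slope > - golden_slope"
      using Ls by (simp add: algebra_simps)
    then have "golden_slope * (s - real m * golden_slope) < golden_slope * 1"
      using arg_cong[OF golden_slope_square, of "\<lambda>t. real m * t"] by (simp add: algebra_simps power2_eq_square)
    then have 2: "s - real m * golden_slope < 1"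
      using golden_slope_bounds by (subst (asm) mult_less_cancel_left_pos) auto
    show ?thesis using 1 2 s_def by (simp add: abs_less_iff)
  qed
  show ?thesis unfolding golden_def
  proof (intro allI)
    fix j m
    obtain z' where z': "golden z'" "shd z' = 1" "sdrop j (desub z) = desub z'"
      using desub_sdrop[OF assms] by blast
    show "\<bar>real_of_int (ones (desub z) j m) - real m * golden_slope\<bar> < 1"
      using *[OF z'(1,2), of m] ones_sdrop[of j "desub z" 0 m] z'(3) by simp
  qed
qed

section \<open>The words M and the levels of a word\<close>

lemma length_M: "length (M k) = fib (Suc k)"
  by (induction k rule: M.induct) auto

text \<open>Both products at the next level start with \<open>M (Suc k)\<close>, followed by the two
  products of the present level in exchanged order. So the last two letters are swapped at each
  step.\<close>

lemma M_commute_but_last_two: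
  "\<exists>a b. a \<noteq> b \<and> M k @ M (Suc k) = M_tilde (Suc k) @ [a, b] \<and> M (Suc k) @ M k = M_tilde (Suc k) @ [b, a]"
proof (induction k)
  case 0
  show ?case by (simp add: M_tilde_def)
next
  case (Suc k)
  then obtain a b where ab: "a \<noteq> b" "M k @ M (Suc k) = M_tilde (Suc k) @ [a, b]"
    "M (Suc k) @ M k = M_tilde (Suc k) @ [b, a]" by blast
  have 1: "M (Suc k) @ M (Suc (Suc k)) = (M (Suc k) @ M_tilde (Suc k)) @ [b, a]" using ab(3) by simp
  have 2: "M (Suc (Suc k)) @ M (Suc k) = (M (Suc k) @ M_tilde (Suc k)) @ [a, b]" using ab(2) by simp
  have "M_tilde (Suc (Suc k)) = M (Suc k) @ M_tilde (Suc k)"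
    unfolding M_tilde_def[of "Suc (Suc k)"] using 2 by (simp add: butlast_append)
  then show ?case using 1 2 ab(1) by metis
qed

lemma M_shift_commute_but_last_two:
  "\<exists>a b. a \<noteq> b \<and> (\<forall>u. M k @- M (Suc k) @- u = M_tilde (Suc k) @- a ## b ## u) \<and>
    (\<forall>u. M (Suc k) @- M k @- u = M_tilde (Suc k) @- b ## a ## u)"
proof -
  obtain a b where ab: "a \<noteq> b" "M k @ M (Suc k) = M_tilde (Suc k) @ [a, b]"
    "M (Suc k) @ M k = M_tilde (Suc k) @ [b, a]" using M_commute_but_last_two by blast
  have "M k @- M (Suc k) @- u = M_tilde (Suc k) @- a ## b ## u"
    "M (Suc k) @- M k @- u = M_tilde (Suc k) @- b ## a ## u" for u
    using arg_cong[OF ab(2), of "\<lambda>l. l @- u"] arg_cong[OF ab(3), of "\<lambda>l. l @- u"] by (simp_all del: M.simps)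
  then show ?thesis using ab(1) by blast
qed

lemma M_tilde_Suc: "M_tilde (Suc (Suc k)) = M (Suc k) @ M_tilde (Suc k)"
proof -
  obtain a b where ab: "M k @ M (Suc k) = M_tilde (Suc k) @ [a, b]"
    using M_commute_but_last_two by blast
  then have "M (Suc (Suc k)) @ M (Suc k) = (M (Suc k) @ M_tilde (Suc k)) @ [a, b]" by simp
  then show ?thesis unfolding M_tilde_def[of "Suc (Suc k)"] by (simp add: butlast_append)
qed

lemma length_M_tilde: "length (M_tilde (Suc k)) = fib (k + 3) - 2"
  by (simp add: M_tilde_def length_M numeral_3_eq_3)

definition blk :: "nat \<Rightarrow> int \<Rightarrow> int list" where
  "blk k c = (if c = 1 then M (Suc k) else M k)"

abbreviation expand :: "nat \<Rightarrow> int stream \<Rightarrow> int stream" where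
  "expand k z \<equiv> flat (smap (blk k) z)"

lemma M_nonempty [simp]: "M k \<noteq> []"
  by (induction k rule: M.induct) auto

lemma expand_SCons [simp]: "expand k (c ## z) = blk k c @- expand k z"
  by (simp add: flat_Stream blk_def)

text \<open>The letter 1 at the upper level and the pair 10 at the lower one both expand to
  \<open>M (k + 2)\<close>; likewise 0 above and 1 below both expand to \<open>M (k + 1)\<close>.
  Blocks are nonempty, so strong induction on the compared position works.\<close>

lemma expand_desub:
  assumes "golden z" "shd z = 1"
  shows "expand (Suc k) (desub z) = expand k z"
proof -
  have "expand (Suc k) (desub z) !! n = expand k z !! n" for n
    using assms
  proof (induction n arbitrary: z rule: less_induct)
    case (less n)
    from less.prems show ?case
    proof (cases rule: golden_desub_cases)
      case (ten z')
      have "expand (Suc k) (desub z) = M (Suc (Suc k)) @- expand (Suc k) (desub z')"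
        "expand k z = M (Suc (Suc k)) @- expand k z'"
        by (simp_all add: ten(1) ten(4)[unfolded ten(1)] blk_def)
      moreover have "length (M (Suc (Suc k))) > 0" by simp
      ultimately show ?thesis
        using less.IH[OF _ ten(2,3), of "n - length (M (Suc (Suc k)))"]
        by (cases "n < length (M (Suc (Suc k)))") (simp_all only: shift_snth, auto)
    next
      case (one z')
      have "expand (Suc k) (desub z) = M (Suc k) @- expand (Suc k) (desub z')"
        "expand k z = M (Suc k) @- expand k z'"
        by (simp_all add: one(1) one(4)[unfolded one(1)] blk_def)
      moreover have "length (M (Suc k)) > 0" by simp
      ultimately show ?thesis
        using less.IH[OF _ one(2,3), of "n - length (M (Suc k))"]
        by (cases "n < length (M (Suc k))") (simp_all only: shift_snth, auto)
    qed
  qed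
  then show ?thesis by (metis stream_smap_nats ext)
qed

text \<open>With \<open>z = level x k\<close>, the word \<open>x\<close> is \<open>lead x k\<close>, a suffix of the block of the first letter of
  \<open>z\<close>, followed by the blocks of the other letters. Levels count from \<open>0\<close> here: \<open>level x k\<close> yields the
  symbol at position \<open>k + 1\<close> of the locating chain.\<close>

definition symb :: "int stream \<Rightarrow> symbol" where
  "symb z = (if shd z = 0 then Case_iii else if shd (stl z) = 0 then Case_ii else Case_i)"

primrec level :: "int stream \<Rightarrow> nat \<Rightarrow> int stream" where
  "level x 0 = x"
| "level x (Suc k) = desub (if shd (level x k) = 0 then 1 ## level x k else level x k)"

primrec lead :: "int stream \<Rightarrow> nat \<Rightarrow> int list" where
  "lead x 0 = [shd x]"
| "lead x (Suc k) = lead x k @ (if symb (level x k) = Case_ii then M k else [])"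

lemma golden_level: "golden x \<Longrightarrow> golden (level x k)"
  by (induction k) (auto intro!: golden_desub golden_SCons_1 dest: golden_shd)

lemma expand_0:
  assumes "golden z" shows "expand 0 z = z"
proof -
  have "expand 0 z !! n = z !! n" for n
    using assms
  proof (induction n arbitrary: z)
    case (0 z)
    have "expand 0 z = blk 0 (shd z) @- expand 0 (stl z)" by (metis expand_SCons stream.collapse)
    then show ?case using golden_shd[OF 0] by (auto simp: blk_def)
  next
    case (Suc n)
    have "expand 0 z = blk 0 (shd z) @- expand 0 (stl z)" by (metis expand_SCons stream.collapse)
    then show ?case using golden_shd[OF Suc.prems] Suc.IH[OF golden_stl[OF Suc.prems]]
      by (auto simp: blk_def)
  qed
  then show ?thesis by (metis stream_smap_nats ext)
qed

lemma golden_first_two_cases: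
  assumes "golden z"
  obtains (zero) z' where "z = 0 ## 1 ## z'" "golden z'" "symb z = Case_iii"
    | (ten) z' where "z = 1 ## 0 ## z'" "golden z'" "symb z = Case_ii"
    | (one) z' where "z = 1 ## 1 ## z'" "golden z'" "symb z = Case_i"
proof -
  have z: "z = shd z ## shd (stl z) ## stl (stl z)" by simp
  have g: "golden (stl (stl z))" using assms golden_stl by blast
  have "shd z = 0 \<or> shd z = 1" "shd (stl z) = 0 \<or> shd (stl z) = 1"
    using golden_shd assms golden_stl by blast+
  moreover have "shd (stl z) = 1" if "shd z = 0" using golden_after_0[OF assms, of 0] that by simp
  ultimately consider "shd z = 0" "shd (stl z) = 1" | "shd z = 1" "shd (stl z) = 0"
    | "shd z = 1" "shd (stl z) = 1" by blast
  then show ?thesis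
    by cases (use zero ten one z g in \<open>(metis symb_def zero_neq_one)+\<close>)
qed

text \<open>A leading 10 fuses into one block, so \<open>lead\<close> gains a full
  \<open>M k\<close>. A leading 11 turns the first letter into 0 with the same block
  \<open>M (k + 1)\<close>. A leading 0 is preceded by a virtual 1, and \<open>lead\<close> stays a
  suffix of the larger block \<open>M (k + 1) @ M k\<close>.\<close>

lemma lead_decomposition:
  assumes "golden x"
  shows "x = lead x k @- expand k (stl (level x k)) \<and> lead x k \<noteq> [] \<and>
    suffix (lead x k) (blk k (shd (level x k)))"
proof (induction k)
  case 0
  then show ?case
    using expand_0[OF golden_stl[OF assms]] golden_shd[OF assms] by (simp, auto simp: blk_def)
next
  case (Suc k)
  define z where "z = level x k"
  have g: "golden z" using golden_level[OF assms] by (simp add: z_def)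
  have IH: "x = lead x k @- expand k (stl z)" "lead x k \<noteq> []" "suffix (lead x k) (blk k (shd z))"
    using Suc by (simp_all add: z_def)
  have lv: "level x (Suc k) = desub (if shd z = 0 then 1 ## z else z)" by (simp add: z_def)
  have ld: "lead x (Suc k) = lead x k @ (if symb z = Case_ii then M k else [])" by (simp add: z_def)
  show ?case
  proof (cases "shd z = 0")
    case True
    have g': "golden (stl z)" "shd (stl z) = 1"
      using golden_stl[OF g] golden_after_0[OF g, of 0] True by simp_all
    have lv': "level x (Suc k) = 1 ## desub (stl z)"
      using lv True desub_simps(1)[of "1 ## z"] by simp
    have "symb z = Case_iii" using True by (simp add: symb_def)
    then show ?thesis using IH True lv' ld expand_desub[OF g']
      by (simp del: level.simps lead.simps M.simps) (simp add: blk_def suffix_append)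
  next
    case False
    then have s: "shd z = 1" using golden_shd[OF g] by simp
    from g s show ?thesis
    proof (cases rule: golden_desub_cases)
      case (ten z')
      have "symb z = Case_ii" using ten(1) by (simp add: symb_def)
      then show ?thesis using IH s lv ld ten(1) ten(4)[unfolded ten(1)] expand_desub[OF ten(2,3)]
        by (simp del: level.simps lead.simps) (auto simp: blk_def suffix_def)
    next
      case (one z')
      have "symb z = Case_i" using one(1,3) by (simp add: symb_def)
      then show ?thesis using IH s lv ld one(1) one(4)[unfolded one(1)] expand_desub[OF one(2,3)]
        by (simp del: level.simps lead.simps) (auto simp: blk_def)
    qed
  qed
qed

text \<open>The words 01 and 10 give the two products of \<open>M k\<close> and
  \<open>M (Suc k)\<close>, which share \<open>M_tilde (Suc k)\<close>. For 11 the second block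
  itself begins with \<open>M k\<close> when \<open>k > 0\<close>, and \<open>M_tilde 1\<close> is
  empty.\<close>

lemma expand_prefix:
  assumes "golden z" shows "\<exists>y. expand k z = M_tilde (Suc k) @- y"
proof -
  obtain a b where ab: "M k @ M (Suc k) = M_tilde (Suc k) @ [a, b]"
    "M (Suc k) @ M k = M_tilde (Suc k) @ [b, a]" using M_commute_but_last_two by blast
  from assms show ?thesis
  proof (cases rule: golden_first_two_cases)
    case (zero z')
    have "expand k z = (M k @ M (Suc k)) @- expand k z'" by (simp add: zero(1) blk_def del: M.simps)
    then show ?thesis unfolding ab by auto
  next
    case (ten z')
    have "expand k z = (M (Suc k) @ M k) @- expand k z'" by (simp add: ten(1) blk_def del: M.simps)
    then show ?thesis unfolding ab by auto
  next
    case (one z')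
    show ?thesis
    proof (cases k)
      case 0 then show ?thesis by (simp add: M_tilde_def)
    next
      case (Suc j)
      have "expand k z = (M (Suc k) @ M k) @- M j @- expand k z'" by (simp add: one(1) blk_def Suc)
      then show ?thesis unfolding ab by auto
    qed
  qed
qed

section \<open>The locating chain\<close>

lemma in_case_level:
  assumes "golden x" shows "in_case x (Suc k) (symb (level x k))"
proof -
  have d: "x = lead x k @- expand k (stl (level x k))" "lead x k \<noteq> []"
    "suffix (lead x k) (blk k (shd (level x k)))" using lead_decomposition[OF assms, of k] by auto
  from golden_level[OF assms, of k] show ?thesis
  proof (cases rule: golden_first_two_cases)
    case (zero z')
    obtain y where "expand k z' = M_tilde (Suc k) @- y" using expand_prefix[OF zero(2)] by blast
    then show ?thesis using d zero(1,3)
      by (auto simp: blk_def simp del: M.simps intro!: exI[of _ "lead x k"] exI[of _ y])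
  next
    case (ten z')
    have s: "stl (level x k) = 0 ## z'" "shd (level x k) = 1" using ten(1) by simp_all
    \<comment> \<open>Case (ii) prescribes two full blocks behind \<open>W\<close>, so the third
      letter matters: it follows a 0 and hence is 1.\<close>
    have "golden (stl (level x k))" by (rule golden_stl[OF golden_level[OF assms]])
    moreover have "shd (stl (level x k)) = 0" using s by simp
    ultimately have "shd z' = 1" using golden_after_0[of "stl (level x k)" 0] s by simp
    then have z': "z' = 1 ## stl z'" by (metis stream.collapse)
    obtain y where y: "expand k (stl z') = M_tilde (Suc k) @- y" using expand_prefix[OF golden_stl[OF ten(2)]] by blast
    have "expand k z' = M (Suc k) @- M_tilde (Suc k) @- y"
      by (subst z', subst expand_SCons) (simp add: blk_def y)
    then show ?thesis using d ten(3) s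
      by (auto simp: blk_def simp del: M.simps intro!: exI[of _ "lead x k"] exI[of _ y])
  next
    case (one z')
    obtain y where "expand k z' = M_tilde (Suc k) @- y" using expand_prefix[OF one(2)] by blast
    then show ?thesis using d one(1,3)
      by (auto simp: blk_def simp del: M.simps intro!: exI[of _ "lead x k"] exI[of _ y])
  qed
qed

section \<open>Uniqueness of the case and of the word \<open>W\<close> at each level\<close>

definition located :: "int stream \<Rightarrow> nat \<Rightarrow> symbol \<Rightarrow> int list \<Rightarrow> bool" where
  "located x k c W \<longleftrightarrow> W \<noteq> [] \<and>
    suffix W (if c = Case_iii then M (k - 1) else M k) \<and>
    (\<exists>y. x = W @- (if c = Case_ii then M (k - 1) else []) @- M k @- M_tilde k @- y)"

lemma in_case_iff_located: "in_case x k c \<longleftrightarrow> (\<exists>W. located x k c W)"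
  by (cases c) (auto simp: located_def)

text \<open>Passing from level \<open>k + 1\<close> to level \<open>k\<close> loses no information on the word \<open>W\<close>, since (iii)
  becomes (i) and otherwise the symbol at level \<open>k\<close> tells whether \<open>W\<close> was shortened.\<close>

lemma located_descend:
  assumes "located x (Suc (Suc k)) c W"
  shows "\<exists>d V. located x (Suc k) d V \<and> (c = Case_iii \<longleftrightarrow> d = Case_i) \<and>
    W = (if d = Case_ii then V @ M k else V)"
proof -
  obtain y where W: "W \<noteq> []" "suffix W (if c = Case_iii then M (Suc k) else M (Suc (Suc k)))"
    and x: "x = W @- (if c = Case_ii then M (Suc k) else []) @- M (Suc (Suc k)) @- M_tilde (Suc (Suc k)) @- y"
    using assms unfolding located_def diff_Suc_1 by blast
  have x': "x = W @- (if c = Case_ii then M (Suc k) else []) @- M (Suc k) @- M k @- M (Suc k) @- M_tilde (Suc k) @- y"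
    using x M_tilde_Suc by simp
  obtain a b where ab: "a \<noteq> b"
    and mk: "\<And>u. M k @- M (Suc k) @- u = M_tilde (Suc k) @- a ## b ## u"
    "\<And>u. M (Suc k) @- M k @- u = M_tilde (Suc k) @- b ## a ## u"
    using M_shift_commute_but_last_two[of k] by blast
  show ?thesis
  proof (cases "c = Case_iii")
    case True
    then have "located x (Suc k) Case_i W" using W x' unfolding located_def
      by (auto simp: mk(1) simp del: M.simps)
    then show ?thesis using True by (intro exI[of _ Case_i] exI[of _ W]) simp
  next
    case False
    have sf: "suffix W (M (Suc k) @ M k)" using W(2) False by simp
    define r where "r = (if c = Case_ii then M (Suc k) else []) @- M (Suc k) @- M k @- M (Suc k) @- M_tilde (Suc k) @- y"
    have xr: "x = W @- r" using x' r_def by simp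
    \<comment> \<open>Behind the first \<open>M (Suc k)\<close> stands \<open>M k\<close> followed
      by \<open>M (Suc k)\<close> in case (i) and the other order in case (ii). Both orders begin
      with \<open>M_tilde (Suc k)\<close>.\<close>
    have "\<exists>y. r = M (Suc k) @- M_tilde (Suc k) @- y"
    proof (cases "c = Case_ii")
      case True
      then show ?thesis unfolding r_def by (auto simp: mk(2) simp del: M.simps)
    next
      case False
      then show ?thesis unfolding r_def by (auto simp: mk(1) simp del: M.simps)
    qed
    then obtain u where r: "r = M (Suc k) @- M_tilde (Suc k) @- u" by blast
    \<comment> \<open>A suffix of \<open>M (Suc k) @ M k\<close> that does not fit into
      \<open>M k\<close> ends with all of \<open>M k\<close>. The part before it is the word of the
      lower level, where the symbol is then (ii).\<close>
    have "\<exists>V. V \<noteq> [] \<and> W = V @ M k \<and> suffix V (M (Suc k))" if "\<not> suffix W (M k)"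
    proof -
      obtain V where "W = V @ M k" "suffix V (M (Suc k))" using sf \<open>\<not> suffix W (M k)\<close>
        unfolding suffix_append by auto
      moreover have "V \<noteq> []" using \<open>\<not> suffix W (M k)\<close> \<open>W = V @ M k\<close> by auto
      ultimately show ?thesis by blast
    qed
    then consider "suffix W (M k)" | V where "V \<noteq> []" "W = V @ M k" "suffix V (M (Suc k))"
      by blast
    then show ?thesis
    proof cases
      case 1
      then have "located x (Suc k) Case_iii W" using W(1) xr r by (auto simp: located_def simp del: M.simps)
      then show ?thesis using False by (intro exI[of _ Case_iii] exI[of _ W]) simp
    next
      case 2
      have "located x (Suc k) Case_ii V" using 2 xr r by (auto simp: located_def simp del: M.simps)
      then show ?thesis using False 2 by (intro exI[of _ Case_ii] exI[of _ V]) simp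
    qed
  qed
qed

text \<open>At the first level the two leading letters decide. Higher up, the descent fixes
  \<open>W\<close> and whether the symbol is (iii). Symbols (i) and (ii) would continue behind
  \<open>W\<close> with the two products of consecutive words \<open>M\<close> in opposite order,
  which differ in their last two letters.\<close>

lemma located_unique:
  assumes "located x (Suc k) c W" "located x (Suc k) c' W'"
  shows "c = c' \<and> W = W'"
  using assms
proof (induction k arbitrary: c c' W W')
  case 0
  have "W = (if c = Case_iii then [0] else [1]) \<and> shd x = (if c = Case_iii then 0 else 1) \<and>
    (c = Case_i \<longrightarrow> shd (stl x) = 1) \<and> (c = Case_ii \<longrightarrow> shd (stl x) = 0)"
    if "located x (Suc 0) c W" for c W
  proof -
    have "W = (if c = Case_iii then [0] else [1])" using that by (cases c) (auto simp: located_def suffix_Cons)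
    then show ?thesis using that by (cases c) (auto simp: located_def M_tilde_def)
  qed
  from this[OF 0(1)] this[OF 0(2)] show ?case by (cases c; cases c') simp_all
next
  case (Suc k)
  obtain d V where 1: "located x (Suc k) d V" "c = Case_iii \<longleftrightarrow> d = Case_i"
    "W = (if d = Case_ii then V @ M k else V)" using located_descend[OF Suc.prems(1)] by blast
  obtain d' V' where 2: "located x (Suc k) d' V'" "c' = Case_iii \<longleftrightarrow> d' = Case_i"
    "W' = (if d' = Case_ii then V' @ M k else V')" using located_descend[OF Suc.prems(2)] by blast
  have WW: "W = W' \<and> (c = Case_iii \<longleftrightarrow> c' = Case_iii)"
    using Suc.IH[OF 1(1) 2(1)] 1 2 by simp
  have False if h: "located x (Suc (Suc k)) Case_i W" "located x (Suc (Suc k)) Case_ii W"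
  proof -
    obtain y where y: "x = W @- M (Suc (Suc k)) @- M_tilde (Suc (Suc k)) @- y"
      using h(1) by (auto simp: located_def simp del: M.simps)
    obtain y' where y': "x = W @- M (Suc k) @- M (Suc (Suc k)) @- M_tilde (Suc (Suc k)) @- y'"
      using h(2) by (auto simp: located_def simp del: M.simps)
    have "M (Suc (Suc k)) @- M_tilde (Suc (Suc k)) @- y = M (Suc k) @- M (Suc (Suc k)) @- M_tilde (Suc (Suc k)) @- y'"
      using y y' shift_left_inj[of W] by blast
    then have e: "(M (Suc (Suc k)) @ M (Suc k)) @- M_tilde (Suc k) @- y = (M (Suc k) @ M (Suc (Suc k))) @- M_tilde (Suc (Suc k)) @- y'"
      using M_tilde_Suc[of k] by (simp del: M.simps)
    obtain a b where "a \<noteq> b" and ab: "M (Suc k) @ M (Suc (Suc k)) = M_tilde (Suc (Suc k)) @ [a, b]"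
      "M (Suc (Suc k)) @ M (Suc k) = M_tilde (Suc (Suc k)) @ [b, a]" using M_commute_but_last_two by blast
    then show False using e unfolding ab by simp
  qed
  then show ?case using WW Suc.prems by (cases c; cases c') auto
qed

lemma locating_chain_nth:
  assumes "golden x" shows "locating_chain x !! k = symb (level x k)"
proof -
  have "(THE c. in_case x (Suc k) c) = symb (level x k)"
    using in_case_level[OF assms, of k] located_unique by (intro the_equality) (auto simp: in_case_iff_located)
  then show ?thesis by (simp add: locating_chain_def)
qed

lemma symb_level_Suc:
  assumes "golden x"
  shows "symb (level x (Suc k)) = Case_iii \<longleftrightarrow> symb (level x k) = Case_i"
  using golden_level[OF assms, of k]
  by (cases rule: golden_first_two_cases) (auto simp: symb_def)

section \<open>Matches and the exponent of repetition\<close>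

text \<open>Positions count from 0, unlike in \<open>factor\<close>. The second occurrence starts
  after \<open>q\<close> letters and ends with letter number \<open>q + n\<close>, which is the
  value compared in \<open>repetition\<close>.\<close>

definition matches :: "'a stream \<Rightarrow> nat \<Rightarrow> nat \<Rightarrow> nat \<Rightarrow> bool" where
  "matches x j q n \<longleftrightarrow> (\<forall>i<n. x !! (j + i) = x !! (q + i))"

lemma factor_eq_iff_matches: "factor x (Suc j) n = factor x (Suc q) n \<longleftrightarrow> matches x j q n"
  by (auto simp: factor_def matches_def list_eq_iff_nth_eq sdrop_snth)

lemma matches_mono: "matches x j q n \<Longrightarrow> m \<le> n \<Longrightarrow> matches x j q m"
  by (simp add: matches_def)

lemma matches_common_prefix:
  assumes "sdrop j x = P @- y" "sdrop q x = P @- y'"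
  shows "matches x j q (length P)"
  unfolding matches_def
proof (intro allI impI)
  fix i assume "i < length P"
  then have "sdrop j x !! i = sdrop q x !! i" using assms by simp
  then show "x !! (j + i) = x !! (q + i)" by (simp add: sdrop_snth)
qed

lemma repetition_le:
  assumes "matches x j q n" "j < q" shows "repetition n x \<le> q + n"
  unfolding repetition_def
  by (rule Least_le, rule exI[of _ "Suc j"]) (use assms factor_eq_iff_matches[of x j n q] in auto)

text \<open>The given match makes the set under \<open>LEAST\<close> nonempty, so the minimum comes
  from an actual match.\<close>

lemma repetition_attained:
  assumes "matches x j q n" "j < q"
  obtains j' q' where "matches x j' q' n" "j' < q'" "repetition n x = q' + n"
proof -
  define P where "P m \<longleftrightarrow> (\<exists>j. 1 \<le> j \<and> j \<le> m - n \<and> factor x j n = factor x (m - n + 1) n)" for m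
  have "P (q + n)" unfolding P_def
    by (rule exI[of _ "Suc j"]) (use assms factor_eq_iff_matches[of x j n q] in auto)
  then have "P (LEAST m. P m)" by (rule LeastI)
  then have "P (repetition n x)" by (simp add: repetition_def P_def)
  then obtain i where i: "1 \<le> i" "i \<le> repetition n x - n"
    "factor x i n = factor x (repetition n x - n + 1) n" unfolding P_def by blast
  obtain j' where "i = Suc j'" using i(1) by (cases i) auto
  then have "matches x j' (repetition n x - n) n"
    using i(3) factor_eq_iff_matches[of x j' n "repetition n x - n"] by simp
  moreover have "j' < repetition n x - n" using i(2) \<open>i = Suc j'\<close> by simp
  ultimately show ?thesis using that by (metis le_add_diff_inverse2 less_imp_le_nat not_less_zero
    zero_less_diff bot_nat_0.not_eq_extremum)
qed

text \<open>The error \<open>C\<close> vanishes after division by \<open>n\<close>; this is why all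
  later estimates may be off by bounded amounts.\<close>

lemma rep_geI:
  assumes "\<And>n. \<exists>j q. j < q \<and> matches x j q n"
    and "\<And>n j q. N \<le> n \<Longrightarrow> j < q \<Longrightarrow> matches x j q n \<Longrightarrow> \<alpha> * real n - C \<le> real q"
  shows "ereal (1 + \<alpha>) \<le> rep x"
proof -
  define g where "g n = ereal (1 + \<alpha> - C / real n)" for n
  have "(\<lambda>n. 1 + \<alpha> - C / real n) \<longlonglongrightarrow> 1 + \<alpha> - 0"
    by (intro tendsto_intros lim_const_over_n)
  then have "g \<longlonglongrightarrow> ereal (1 + \<alpha>)" unfolding g_def by simp
  then have "liminf g = ereal (1 + \<alpha>)" by (simp add: lim_imp_Liminf)
  moreover have "liminf g \<le> rep x" unfolding rep_def
  proof (rule Liminf_mono, unfold eventually_sequentially, intro exI[of _ "Suc N"] allI impI)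
    fix n assume n: "Suc N \<le> n"
    obtain j q where "j < q" "matches x j q n" using assms(1) by blast
    then obtain j' q' where q': "j' < q'" "matches x j' q' n" "repetition n x = q' + n"
      using repetition_attained by metis
    have "\<alpha> * real n - C \<le> real q'" using assms(2) q' n by simp
    then have "(\<alpha> * real n - C) / real n \<le> real q' / real n" by (rule divide_right_mono) simp
    then show "g n \<le> ereal (real (repetition n x) / real n)"
      using n q'(3) by (simp add: g_def diff_divide_distrib add_divide_distrib)
  qed
  ultimately show ?thesis by simp
qed

lemma rep_leI:
  assumes "\<And>N. \<exists>n\<ge>N. \<exists>j q. j < q \<and> matches x j q n \<and> real q \<le> \<alpha> * real n + C"
  shows "rep x \<le> ereal (1 + \<alpha>)"
proof (rule ccontr)
  assume "\<not> rep x \<le> ereal (1 + \<alpha>)"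
  then have "ereal (1 + \<alpha>) < rep x" by (simp only: not_le)
  then obtain c where c: "ereal (1 + \<alpha>) < ereal c" "ereal c < rep x"
    using ereal_dense2 by blast
  then have "eventually (\<lambda>n. ereal c < ereal (real (repetition n x) / real n)) sequentially"
    unfolding rep_def by (intro less_LiminfD)
  then obtain N where N: "\<And>n. n \<ge> N \<Longrightarrow> c < real (repetition n x) / real n"
    unfolding eventually_sequentially by auto
  have pos: "c - 1 - \<alpha> > 0" using c(1) by simp
  \<comment> \<open>Beyond \<open>N'\<close> the slack \<open>c - 1 - \<alpha>\<close>, multiplied
    by \<open>n\<close>, exceeds \<open>C\<close>.\<close>
  obtain N' :: nat where N': "real N' > C / (c - 1 - \<alpha>)" using reals_Archimedean2 by blast
  obtain n j q where n: "n \<ge> max (max N 1) N'" "j < q" "matches x j q n" "real q \<le> \<alpha> * real n + C"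
    using assms by metis
  have "c * real n < real (repetition n x)" using N[of n] n(1) by (simp add: field_simps)
  also have "\<dots> \<le> real q + real n" using repetition_le[OF n(3,2)] by linarith
  finally have "(c - 1 - \<alpha>) * real n < C" using n(4) by (simp add: algebra_simps)
  moreover have "real n > C / (c - 1 - \<alpha>)" using N' n(1) by linarith
  then have "(c - 1 - \<alpha>) * real n > C" using pos by (simp add: field_simps)
  ultimately show False by simp
qed

section \<open>Upper bounds\<close>

definition offset :: "int stream \<Rightarrow> nat \<Rightarrow> nat" where
  "offset x k = length (lead x k)"

lemma offset_Suc:
  "offset x (Suc k) = offset x k + (if symb (level x k) = Case_ii then fib (Suc k) else 0)"
  by (simp add: offset_def length_M)

lemma offset_pos:
  assumes "golden x" shows "0 < offset x k"
  using lead_decomposition[OF assms, of k] by (simp add: offset_def)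

lemma offset_le:
  assumes "golden x"
  shows "offset x k \<le> (if symb (level x k) = Case_iii then fib (k + 1) else fib (k + 2))"
proof -
  have "suffix (lead x k) (blk k (shd (level x k)))" using lead_decomposition[OF assms, of k] by simp
  then have "offset x k \<le> length (blk k (shd (level x k)))"
    unfolding offset_def by (rule suffix_length_le)
  also have "\<dots> = (if shd (level x k) = 1 then fib (k + 2) else fib (k + 1))"
    by (simp add: blk_def length_M)
  finally show ?thesis using golden_shd[OF golden_level[OF assms], of k]
    by (auto simp: symb_def split: if_splits)
qed

text \<open>The shift is \<open>length (M (k + 1))\<close>. It moves \<open>W\<close>, a suffix of
  \<open>M (k + 1)\<close>, onto the end of the \<open>M (k + 1)\<close> behind it. From there
  \<open>M (k + 1) @ M k\<close> faces \<open>M k @ M (k + 1)\<close>, and these agree except in the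
  last two letters.\<close>

lemma match_Case_iii:
  assumes "golden x" "symb (level x (Suc k)) = Case_iii"
  shows "matches x 0 (fib (k + 2)) (offset x (Suc k) + fib (k + 3) - 2)"
proof -
  define W where "W = lead x (Suc k)"
  from golden_level[OF assms(1), of "Suc k"] assms(2) obtain z' where
    z': "level x (Suc k) = 0 ## 1 ## z'" "golden z'"
    by (cases rule: golden_first_two_cases) auto
  have sW: "suffix W (M (Suc k))" and x0: "x = W @- M (Suc (Suc k)) @- expand (Suc k) z'"
    using lead_decomposition[OF assms(1), of "Suc k"] z'(1) unfolding W_def
    by (simp_all add: blk_def del: level.simps lead.simps)
  obtain y where y: "expand (Suc k) z' = M_tilde (Suc (Suc k)) @- y"
    using expand_prefix[OF z'(2)] by blast
  have x: "x = W @- M (Suc k) @- M k @- M (Suc k) @- M_tilde (Suc k) @- y"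
    using x0 y M_tilde_Suc[of k] by simp
  obtain a b where ab: "a \<noteq> b"
    and mk: "\<And>u. M k @- M (Suc k) @- u = M_tilde (Suc k) @- a ## b ## u"
    "\<And>u. M (Suc k) @- M k @- u = M_tilde (Suc k) @- b ## a ## u"
    using M_shift_commute_but_last_two[of k] by blast
  obtain U where U: "M (Suc k) = U @ W" using sW by (auto simp: suffix_def)
  have len: "length (W @ U) = fib (k + 2)" using arg_cong[OF U, of length] length_M[of "Suc k"] by simp
  have "x = (W @ U) @- W @- M k @- M (Suc k) @- M_tilde (Suc k) @- y"
    by (subst x, subst U) simp
  then have "sdrop (length (W @ U)) x = W @- M k @- M (Suc k) @- M_tilde (Suc k) @- y"
    by (metis sdrop_shift diff_self_eq_0 drop_all order_refl shift.simps(1) sdrop.simps(1))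
  then have 1: "sdrop (fib (k + 2)) x = (W @ M_tilde (Suc k)) @- a ## b ## M_tilde (Suc k) @- y"
    unfolding len mk by simp
  have 2: "sdrop 0 x = (W @ M_tilde (Suc k)) @- b ## a ## M (Suc k) @- M_tilde (Suc k) @- y"
    by (subst x) (simp add: mk(2) del: M.simps)
  have "fib (k + 3) \<ge> 2" using fib_mono[of 3 "k + 3"] by (simp add: numeral_3_eq_3)
  then have "length (W @ M_tilde (Suc k)) = offset x (Suc k) + fib (k + 3) - 2"
    by (simp add: length_M_tilde W_def offset_def del: lead.simps)
  then show ?thesis using matches_common_prefix[OF 2 1] by simp
qed

text \<open>The block \<open>M k\<close> behind \<open>W\<close> is the shift. An expansion at level
  \<open>k\<close> starts before it and another one after it, and every such expansion begins with
  \<open>M_tilde (Suc k)\<close>.\<close>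

lemma match_Case_ii:
  assumes "golden x" "symb (level x k) = Case_ii"
  shows "matches x (offset x k) (offset x k + fib (k + 1)) (fib (k + 3) - 2)"
proof -
  from golden_level[OF assms(1), of k] assms(2) obtain z' where
    z': "level x k = 1 ## 0 ## z'" "golden z'"
    by (cases rule: golden_first_two_cases) auto
  have g: "golden (0 ## z')" using golden_stl[OF golden_level[OF assms(1), of k]] z'(1) by simp
  have x: "x = lead x k @- expand k (0 ## z')"
    using lead_decomposition[OF assms(1), of k] z'(1) by (simp del: expand_SCons)
  then have 1: "sdrop (offset x k) x = expand k (0 ## z')"
    unfolding offset_def by (metis sdrop_shift diff_self_eq_0 drop_all order_refl shift.simps(1) sdrop.simps(1))
  have "sdrop (offset x k + fib (k + 1)) x = sdrop (fib (k + 1)) (expand k (0 ## z'))"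
    using 1 sdrop_add by metis
  also have "\<dots> = sdrop (length (M k)) (M k @- expand k z')" by (simp add: blk_def length_M)
  also have "\<dots> = expand k z'" by (simp add: sdrop_shift)
  finally have 2: "sdrop (offset x k + fib (k + 1)) x = expand k z'" .
  obtain y y' where "expand k (0 ## z') = M_tilde (Suc k) @- y" "expand k z' = M_tilde (Suc k) @- y'"
    using expand_prefix[OF g, of k] expand_prefix[OF z'(2), of k] by blast
  from matches_common_prefix[OF trans[OF 1 this(1)] trans[OF 2 this(2)]]
  show ?thesis by (simp add: length_M_tilde)
qed

text \<open>Completing \<open>W\<close> on the left to the full block \<open>M (k + 2)\<close> again
  lets \<open>M (k + 1) @ M k\<close> face \<open>M k @ M (k + 1)\<close>; removing the added
  letters leaves a match of length about \<open>|W|\<close>. This is valuable when \<open>W\<close>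
  is nearly the whole block, as after a long run of (ii).\<close>

lemma match_Case_ii_start:
  assumes "golden x" "symb (level x (Suc k)) = Case_ii"
  shows "matches x 0 (fib (k + 2)) (offset x (Suc k) - 2)"
proof -
  define W where "W = lead x (Suc k)"
  from golden_level[OF assms(1), of "Suc k"] assms(2) obtain z' where
    z': "level x (Suc k) = 1 ## 0 ## z'" "golden z'"
    by (cases rule: golden_first_two_cases) auto
  have sW: "suffix W (M (Suc (Suc k)))" and x: "x = W @- M (Suc k) @- expand (Suc k) z'"
    using lead_decomposition[OF assms(1), of "Suc k"] z'(1) unfolding W_def
    by (simp_all add: blk_def del: level.simps lead.simps)
  obtain V where V: "M (Suc (Suc k)) = V @ W" using sW by (auto simp: suffix_def)
  have full: "V @- x = M (Suc k) @- M k @- M (Suc k) @- expand (Suc k) z'"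
    using arg_cong[OF V, of "\<lambda>l. l @- M (Suc k) @- expand (Suc k) z'"] by (subst x) simp
  obtain a b where ab: "a \<noteq> b"
    and mk: "\<And>u. M k @- M (Suc k) @- u = M_tilde (Suc k) @- a ## b ## u"
    "\<And>u. M (Suc k) @- M k @- u = M_tilde (Suc k) @- b ## a ## u"
    using M_shift_commute_but_last_two[of k] by blast
  have 1: "sdrop 0 (V @- x) = M_tilde (Suc k) @- b ## a ## M (Suc k) @- expand (Suc k) z'"
    unfolding full by (simp add: mk(2) del: M.simps)
  have "sdrop (length (M (Suc k))) (V @- x) = M k @- M (Suc k) @- expand (Suc k) z'"
    unfolding full by (simp add: sdrop_shift del: M.simps)
  then have 2: "sdrop (fib (k + 2)) (V @- x) = M_tilde (Suc k) @- a ## b ## expand (Suc k) z'"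
    by (simp add: mk(1) length_M del: M.simps)
  have m: "matches (V @- x) 0 (fib (k + 2)) (length V + offset x (Suc k) - 2)"
    using matches_common_prefix[OF 1 2] arg_cong[OF V, of length] length_M[of "Suc (Suc k)"]
    by (simp add: length_M_tilde numeral_3_eq_3 W_def offset_def)
  show ?thesis unfolding matches_def
  proof (intro allI impI)
    fix i assume "i < offset x (Suc k) - 2"
    then have "length V + i < length V + offset x (Suc k) - 2" by linarith
    then have "(V @- x) !! (0 + (length V + i)) = (V @- x) !! (fib (k + 2) + (length V + i))"
      using m unfolding matches_def by blast
    moreover have "fib (k + 2) + (length V + i) - length V = fib (k + 2) + i" by linarith
    ultimately show "x !! (0 + i) = x !! (fib (k + 2) + i)"
      by (simp add: shift_snth del: add_2_eq_Suc' fib.simps)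
  qed
qed

section \<open>Periods of long matches\<close>

lemma fib_golden_slope:
  "real (fib (Suc m)) * golden_slope - real (fib m) = (-1) ^ m * golden_slope ^ Suc m"
proof (induction m rule: fib.induct)
  case 2
  show ?case using golden_slope_square by (simp add: power2_eq_square)
next
  case (3 m)
  have "real (fib (Suc (Suc (Suc m)))) * golden_slope - real (fib (Suc (Suc m))) =
    (-1) ^ m * golden_slope ^ Suc m * (1 - golden_slope)"
    using 3 by (simp add: algebra_simps)
  also have "\<dots> = (-1) ^ m * golden_slope ^ Suc m * golden_slope ^ 2"
    using golden_slope_square by simp
  finally show ?case by (simp add: power2_eq_square)
qed simp

lemma fib_Cassini_minus_one_power:
  "int (fib (Suc (Suc l))) * int (fib l) - int (fib (Suc l)) * int (fib (Suc l)) = (-1) ^ Suc l"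
  using fib_Cassini_int[of l] by (simp only: of_nat_mult power2_eq_square of_nat_power power_Suc mult_minus1)

text \<open>The pair \<open>(q, r)\<close> is written in the lattice basis of two consecutive
  convergents, whose determinant is a sign by Cassini's identity. With coordinates \<open>a\<close>,
  \<open>b\<close> the signed error is \<phi>^(l+1) (a\<phi> - b). The bounds then leave
  \<open>b \<ge> 0\<close> with \<open>a \<ge> 1\<close>, so that \<open>q\<close> is too large, or
  \<open>b < 0\<close> with \<open>a \<le> 0\<close>, so that \<open>q\<close> is not
  positive.\<close>

lemma one_sided_best_approximation:
  fixes r :: int
  assumes "0 < q" "q < fib (Suc (Suc l))"
    and "0 < (-1) ^ Suc l * (real q * golden_slope - real_of_int r)"
    and "(-1) ^ Suc l * (real q * golden_slope - real_of_int r) < 2 * golden_slope ^ Suc (Suc l)"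
  shows False
proof -
  define e :: int where "e = (-1) ^ Suc l"
  define A B C where "A = int (fib (Suc (Suc l)))" and "B = int (fib (Suc l))" and "C = int (fib l)"
  have det: "A * C - B * B = e" unfolding A_def B_def C_def e_def by (rule fib_Cassini_minus_one_power)
  have ee: "e * e = 1" by (simp add: e_def flip: power_mult_distrib)
  define a b where "a = e * (int q * C - r * B)" and "b = e * (r * A - int q * B)"
  have "a * A + b * B = e * (A * C - B * B) * int q" unfolding a_def b_def by (simp add: algebra_simps)
  then have q: "int q = a * A + b * B" using det ee by simp
  have "a * B + b * C = e * (A * C - B * B) * r" unfolding a_def b_def by (simp add: algebra_simps)
  then have r: "r = a * B + b * C" using det ee by simp
  have re: "real_of_int e = (-1) ^ Suc l" by (simp add: e_def)
  have ree: "real_of_int e * real_of_int e = 1" using ee by (metis of_int_1 of_int_mult)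
  have A: "real_of_int A * golden_slope - real_of_int B = real_of_int e * golden_slope ^ Suc (Suc l)"
    using fib_golden_slope[of "Suc l"] unfolding A_def B_def re by simp
  have B: "real_of_int B * golden_slope - real_of_int C = - real_of_int e * golden_slope ^ Suc l"
    using fib_golden_slope[of l] unfolding B_def C_def re by simp
  have "real q * golden_slope - real_of_int r =
    real_of_int a * (real_of_int A * golden_slope - real_of_int B) +
    real_of_int b * (real_of_int B * golden_slope - real_of_int C)"
    using arg_cong[OF q, of real_of_int] arg_cong[OF r, of real_of_int] by (simp add: algebra_simps)
  also have "\<dots> = real_of_int e * golden_slope ^ Suc l * (real_of_int a * golden_slope - real_of_int b)"
    unfolding A B by (simp add: algebra_simps)
  finally have "(-1) ^ Suc l * (real q * golden_slope - real_of_int r) =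
    golden_slope ^ Suc l * (real_of_int a * golden_slope - real_of_int b)"
    unfolding re[symmetric] using ree by (simp add: mult.assoc[symmetric])
  with assms(3,4) have
    "golden_slope ^ Suc l * 0 < golden_slope ^ Suc l * (real_of_int a * golden_slope - real_of_int b)"
    "golden_slope ^ Suc l * (real_of_int a * golden_slope - real_of_int b) < golden_slope ^ Suc l * (2 * golden_slope)"
    by (simp_all add: mult.assoc mult.commute)
  moreover have "golden_slope ^ Suc l > 0" using golden_slope_bounds by simp
  ultimately have ab: "0 < real_of_int a * golden_slope - real_of_int b"
    "real_of_int a * golden_slope - real_of_int b < 2 * golden_slope"
    by (metis mult_less_cancel_left_pos)+
  have pos: "A > 0" "B > 0" unfolding A_def B_def using fib_neq_0_nat by (simp_all only: of_nat_0_less_iff zero_less_Suc)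
  show False
  proof (cases "b \<ge> 0")
    case True
    then have "0 < real_of_int a * golden_slope" using ab(1) by linarith
    then have "a \<ge> 1" using golden_slope_bounds by (simp add: zero_less_mult_iff)
    then have "a * A \<ge> 1 * A" using pos by (intro mult_right_mono) auto
    moreover have "b * B \<ge> 0" using True pos by simp
    ultimately have "int q \<ge> A" using q by linarith
    then show False using assms(2) by (simp add: A_def)
  next
    case False
    then have "real_of_int b \<le> -1" by linarith
    then have "real_of_int a * golden_slope < 1 * golden_slope" using ab(2) golden_slope_bounds by linarith
    then have "a \<le> 0" using golden_slope_bounds by (subst (asm) mult_less_cancel_right_pos) auto
    then have "a * A \<le> 0" "b * B \<le> 0" using pos False by (simp_all add: mult_nonpos_nonneg)
    then show False using q assms(1) by linarith
  qed
qed

lemma ones_fib_window: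
  assumes "golden z"
  shows "ones z t (fib (Suc m)) = int (fib m) \<or> ones z t (fib (Suc m)) = int (fib m) + (-1) ^ m"
proof -
  define d where "d = ones z t (fib (Suc m)) - int (fib m)"
  have g: "golden_slope ^ Suc m > 0" "golden_slope ^ Suc m < 1"
    using golden_slope_bounds by (simp, intro power_Suc_less_one) simp_all
  have "\<bar>real_of_int d + real (fib m) - real (fib (Suc m)) * golden_slope\<bar> < 1"
    using goldenD[OF assms, of t "fib (Suc m)"] by (simp add: d_def)
  then have "\<bar>real_of_int d - (-1) ^ m * golden_slope ^ Suc m\<bar> < 1"
    using fib_golden_slope[of m] by (simp add: algebra_simps)
  then have "d = 0 \<or> d = (-1) ^ m" using g by (cases "even m") (simp; linarith)+
  then show ?thesis by (auto simp: d_def)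
qed

text \<open>The union and the overlap of the two windows together have the counts of both. As the
  union is balanced, the overlap must take nearly the largest deviation allowed, which one-sided
  approximation excludes for its length.\<close>

lemma ones_fib_window_unbalanced_unique:
  assumes "golden z" "t < t'" "t' < t + fib (Suc (Suc l))"
    and "ones z t (fib (Suc (Suc l))) = int (fib (Suc l)) + (-1) ^ Suc l"
    and "ones z t' (fib (Suc (Suc l))) = int (fib (Suc l)) + (-1) ^ Suc l"
  shows False
proof -
  define N where "N = fib (Suc (Suc l))"
  define d where "d = t' - t"
  define q where "q = N - d"
  have dN: "0 < d" "d < N" "t' = t + d" "N = d + q" "0 < q" "q < N"
    using assms(2,3) unfolding N_def d_def q_def by auto
  \<comment> \<open>Correcting the count of the overlap by the sign puts its error into the excluded
    one-sided interval.\<close>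
  define r where "r = ones z t' q - (-1) ^ Suc l"
  have un: "ones z t (N + d) = ones z t d + ones z t' N"
    using ones_add[of z t d N] dN by (simp add: add.commute)
  have "ones z t N = ones z t d + ones z t' q" using ones_add[of z t d q] dN by simp
  then have tot: "ones z t (N + d) + ones z t' q = 2 * (int (fib (Suc l)) + (-1) ^ Suc l)"
    using un assms(4,5) by (simp add: N_def)
  have c: "real N * golden_slope - real (fib (Suc l)) = (-1) ^ Suc l * golden_slope ^ Suc (Suc l)"
    unfolding N_def by (rule fib_golden_slope)
  have tot': "real_of_int (ones z t (N + d)) - real (N + d) * golden_slope +
    (real_of_int (ones z t' q) - real q * golden_slope) =
    (-1) ^ Suc l * (2 - 2 * golden_slope ^ Suc (Suc l))"
    using arg_cong[OF tot, of real_of_int] c dN(4) by (simp add: algebra_simps)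
  have 1: "\<bar>real_of_int (ones z t (N + d)) - real (N + d) * golden_slope\<bar> < 1"
    and 2: "\<bar>real_of_int (ones z t' q) - real q * golden_slope\<bar> < 1"
    using goldenD[OF assms(1)] by blast+
  have "0 < (-1) ^ Suc l * (real q * golden_slope - real_of_int r) \<and>
    (-1) ^ Suc l * (real q * golden_slope - real_of_int r) < 2 * golden_slope ^ Suc (Suc l)"
    using 1 2 tot' unfolding r_def by (cases "even l") (simp_all add: abs_less_iff)
  then show False using one_sided_best_approximation[of q l r] dN(5,6) unfolding N_def by blast
qed

text \<open>Summing the letters of the windows of length \<open>p\<close> that start inside the match, once by windows
  and once by positions, gives a congruence for \<open>p\<close> modulo a Fibonacci number.\<close>

lemma match_shift_fib:
  assumes "golden z" "matches z j (j + p) n" "0 < p" "p < fib (Suc (Suc l))" "fib (Suc (Suc l)) \<le> n + 1"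
  shows "p = fib (Suc l)"
proof -
  define N where "N = fib (Suc (Suc l))"
  define F where "F = fib (Suc l)"
  define s where "s = ones z j p"
  define e :: int where "e = (-1) ^ Suc l"
  \<comment> \<open>Sliding a window of length \<open>p\<close> along the match exchanges equal
    letters. There are \<open>n + 1\<close> such windows, and \<open>N \<le> n + 1\<close> provides
    the \<open>N\<close> windows summed below.\<close>
  have s: "ones z (j + i) p = s" if "i \<le> n" for i
    using that
  proof (induction i)
    case (Suc i)
    have "ones z (j + i) (Suc p) = ones z (j + i) p + z !! (j + i + p)" by (simp add: ones_def)
    moreover have "ones z (j + i) (Suc p) = z !! (j + i) + ones z (j + Suc i) p"
      using ones_add[of z "j + i" 1 p] by simp
    moreover have "z !! (j + i) = z !! (j + i + p)"
      using assms(2) Suc.prems unfolding matches_def by (simp add: add.commute add.left_commute)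
    ultimately show ?case using Suc by simp
  qed (simp add: s_def)
  define b where "b = {t. t < p \<and> ones z (j + t) N \<noteq> int F}"
  have win: "ones z (j + t) N = int F + (if t \<in> b then e else 0)" if "t < p" for t
    using ones_fib_window[OF assms(1), of "j + t" "Suc l"] that by (auto simp: b_def N_def F_def e_def)
  have "int N * s = (\<Sum>i<N. ones z (j + i) p)" using s assms(5) by (simp add: N_def)
  also have "\<dots> = (\<Sum>t<p. ones z (j + t) N)"
    unfolding ones_def by (subst sum.swap) (simp add: add.commute add.left_commute)
  also have "\<dots> = (\<Sum>t<p. int F + (if t \<in> b then e else 0))" using win by simp
  also have "\<dots> = int p * int F + e * int (card b)"
  proof -
    have "{t. t < p} \<inter> b = b" by (auto simp: b_def)
    then show ?thesis by (simp add: sum.distrib sum.If_cases lessThan_def mult.commute)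
  qed
  finally have Ns: "int N * s = int p * int F + e * int (card b)" .
  have fin: "finite b" by (simp add: b_def)
  \<comment> \<open>Starts below \<open>p\<close> are less than \<open>N\<close> apart, so at most
    one of these windows has the exceptional count.\<close>
  have "t = t'" if tt: "t \<in> b" "t' \<in> b" for t t'
  proof (rule ccontr)
    have h: False if "u < u'" "u \<in> b" "u' \<in> b" for u u'
      using ones_fib_window_unbalanced_unique[OF assms(1), of "j + u" "j + u'" l] that
        win[of u] win[of u'] assms(4) by (auto simp: b_def N_def F_def e_def)
    assume "t \<noteq> t'"
    then show False using h tt by (meson linorder_neqE_nat)
  qed
  then have "card b \<le> Suc 0" using card_le_Suc0_iff_eq[OF fin] by blast
  then consider "card b = 0" | "card b = 1" by linarith
  then show ?thesis
  proof cases
    case 1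
    then have "int N dvd int (p * F)" using Ns by (metis add.right_neutral dvd_triv_left mult_zero_right of_nat_0 of_nat_mult)
    then have "N dvd p * F" by (simp only: int_dvd_int_iff)
    moreover have "coprime N F" unfolding N_def F_def by (metis coprime_fib_Suc_nat coprime_commute)
    ultimately have "N dvd p" by (metis coprime_dvd_mult_left_iff)
    then show ?thesis using assms(3,4) by (auto simp: N_def dest: dvd_imp_le)
  next
    case 2
    have "int N * int (fib l) - int F * int F = e"
      unfolding N_def F_def e_def by (rule fib_Cassini_minus_one_power)
    \<comment> \<open>Subtracting Cassini's identity cancels \<open>e\<close> and leaves a multiple
      of \<open>p - F\<close>.\<close>
    then have "int N * (s - int (fib l)) = (int p - int F) * int F"
      using Ns 2 by (simp add: algebra_simps)
    then have "int N dvd (int p - int F) * int F" by (metis dvd_triv_left)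
    moreover have "coprime (int N) (int F)" unfolding N_def F_def
      by (metis coprime_fib_Suc_nat coprime_commute coprime_int_iff)
    ultimately have dv: "int N dvd int p - int F" by (metis coprime_dvd_mult_left_iff)
    have "\<bar>int p - int F\<bar> < int N" using assms(3,4) by (simp add: N_def F_def)
    then have "int p - int F = 0" using dvd_imp_le_int[OF _ dv] by linarith
    then show ?thesis by (simp add: F_def)
  qed
qed

section \<open>Where a match at a Fibonacci shift must end\<close>

lemma mismatch_near_block_end:
  assumes "Y = M (Suc k) @- M k @- M (Suc k) @- R" "i \<in> {fib (k + 3) - 2, fib (k + 3) - 1}"
  shows "Y !! i \<noteq> Y !! (fib (k + 2) + i)"
proof -
  obtain a b where ab: "a \<noteq> b"
    and mk: "\<And>u. M k @- M (Suc k) @- u = M_tilde (Suc k) @- a ## b ## u"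
    "\<And>u. M (Suc k) @- M k @- u = M_tilde (Suc k) @- b ## a ## u"
    using M_shift_commute_but_last_two[of k] by blast
  define L where "L = length (M_tilde (Suc k))"
  have L: "L = fib (k + 3) - 2" by (simp add: L_def length_M_tilde)
  have "fib (k + 3) \<ge> 2" using fib_mono[of 3 "k + 3"] by (simp add: numeral_3_eq_3)
  then have i: "i = L \<or> i = Suc L" using assms(2) L by auto
  have 1: "Y = M_tilde (Suc k) @- b ## a ## M (Suc k) @- R"
    unfolding assms(1) by (rule mk(2))
  have "sdrop (length (M (Suc k))) Y = M k @- M (Suc k) @- R"
    unfolding assms(1) by (simp add: sdrop_shift del: M.simps)
  then have 2: "sdrop (fib (k + 2)) Y = M_tilde (Suc k) @- a ## b ## R"
    by (simp add: mk(1) length_M del: M.simps)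
  have at: "(M_tilde (Suc k) @- c ## d ## u) !! L = c" "(M_tilde (Suc k) @- c ## d ## u) !! Suc L = d" for c d u
    by (simp_all only: shift_snth L_def) (simp_all add: Suc_diff_le)
  have "Y !! L = b" "Y !! Suc L = a" unfolding 1 by (rule at)+
  moreover have "sdrop (fib (k + 2)) Y !! L = a" "sdrop (fib (k + 2)) Y !! Suc L = b"
    unfolding 2 by (rule at)+
  ultimately show ?thesis using i ab by (auto simp: sdrop_snth simp del: add_2_eq_Suc' fib.simps)
qed

lemma expand_1_mismatch:
  assumes "golden z" "shd z = 1" "i \<in> {fib (k + 3) - 2, fib (k + 3) - 1}"
  shows "expand (Suc k) z !! i \<noteq> expand (Suc k) z !! (fib (k + 2) + i)"
proof -
  have z: "z = 1 ## stl z" using assms(2) by (metis stream.collapse)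
  obtain y where y: "expand (Suc k) (stl z) = M_tilde (Suc (Suc k)) @- y"
    using expand_prefix[OF golden_stl[OF assms(1)]] by blast
  have "expand (Suc k) z = M (Suc k) @- M k @- M (Suc k) @- M_tilde (Suc k) @- y"
    by (subst z, subst expand_SCons, subst y) (simp add: blk_def M_tilde_Suc)
  then show ?thesis using mismatch_near_block_end assms(3) by blast
qed

text \<open>The block of 0 is exactly as long as the shift, and the next letter is 1. The mismatches
  are those at the end of the following block of 1.\<close>

lemma expand_0_1_mismatch:
  assumes "golden z" "shd z = 0" "i \<in> {fib (k + 4) - 2, fib (k + 4) - 1}"
  shows "expand (Suc k) z !! i \<noteq> expand (Suc k) z !! (fib (k + 2) + i)"
proof -
  have z: "z = 0 ## stl z" using assms(2) by (metis stream.collapse)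
  have 1: "shd (stl z) = 1" using golden_after_0[OF assms(1), of 0] assms(2) by simp
  have e: "expand (Suc k) z = M (Suc k) @- expand (Suc k) (stl z)"
    by (subst z, subst expand_SCons) (simp add: blk_def)
  have "fib (k + 4) = fib (k + 3) + fib (k + 2)" by (simp add: numeral_eq_Suc)
  moreover have "fib (k + 3) \<ge> 2" using fib_mono[of 3 "k + 3"] by (simp add: numeral_3_eq_3)
  moreover define i' where "i' = i - fib (k + 2)"
  ultimately have i': "i' \<in> {fib (k + 3) - 2, fib (k + 3) - 1}" "i = fib (k + 2) + i'"
    using assms(3) by (auto simp del: fib.simps)
  have l: "length (M (Suc k)) = fib (k + 2)" by (simp only: length_M add_2_eq_Suc')
  have "expand (Suc k) z !! (fib (k + 2) + j) = expand (Suc k) (stl z) !! j" for j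
    unfolding e by (simp only: shift_snth l) simp
  then show ?thesis
    using expand_1_mismatch[OF golden_stl[OF assms(1)] 1 i'(1)] i'(2) by (simp del: fib.simps add_2_eq_Suc')
qed

text \<open>Each block of 1 has a mismatch at its end, and of two successive blocks at least one
  belongs to a 1; hence the bound by the two block lengths together. The induction strips whole
  blocks that lie before \<open>t\<close>.\<close>

lemma expand_mismatch_within:
  assumes "golden z"
  shows "\<exists>i. t \<le> i \<and> i < t + fib (k + 4) \<and> expand (Suc k) z !! i \<noteq> expand (Suc k) z !! (fib (k + 2) + i)"
  using assms
proof (induction t arbitrary: z rule: less_induct)
  case (less t)
  define c where "c = shd z"
  define b where "b = length (blk (Suc k) c)"
  have "z = c ## stl z" by (simp add: c_def)
  then have "expand (Suc k) z = blk (Suc k) c @- expand (Suc k) (stl z)" by (metis expand_SCons)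
  then have e: "expand (Suc k) z !! (b + j) = expand (Suc k) (stl z) !! j" for j
    unfolding b_def by simp
  have fibs: "fib (k + 4) = fib (k + 3) + fib (k + 2)" "fib (k + 2) > 0" "fib (k + 3) \<ge> 2"
    using fib_mono[of 3 "k + 3"] fib_neq_0_nat[of "k + 2"] by (simp_all add: numeral_eq_Suc)
  have bv: "b = (if c = 1 then fib (k + 3) else fib (k + 2))"
    by (simp add: b_def blk_def length_M numeral_3_eq_3)
  show ?case
  proof (cases "b \<le> t")
    case True
    have "t - b < t" using True fibs bv by (auto split: if_splits)
    from less.IH[OF this golden_stl[OF less.prems]] obtain i where
      i: "t - b \<le> i" "i < t - b + fib (k + 4)"
        "expand (Suc k) (stl z) !! i \<noteq> expand (Suc k) (stl z) !! (fib (k + 2) + i)" by blast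
    have "expand (Suc k) z !! (b + i) \<noteq> expand (Suc k) z !! (fib (k + 2) + (b + i))"
      using i(3) e[of i] e[of "fib (k + 2) + i"] by (metis add.left_commute)
    then show ?thesis using i(1,2) True by (intro exI[of _ "b + i"]) auto
  next
    case False
    show ?thesis
    proof (cases "c = 1")
      case True
      then have "expand (Suc k) z !! (fib (k + 3) - 1) \<noteq> expand (Suc k) z !! (fib (k + 2) + (fib (k + 3) - 1))"
        using expand_1_mismatch[OF less.prems, of _ k] by (simp add: c_def)
      then show ?thesis using False True bv fibs by (intro exI[of _ "fib (k + 3) - 1"]) auto
    next
      case 0: False
      then have "shd z = 0" using golden_shd[OF less.prems] by (auto simp: c_def)
      then have "expand (Suc k) z !! (fib (k + 4) - 1) \<noteq> expand (Suc k) z !! (fib (k + 2) + (fib (k + 4) - 1))"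
        using expand_0_1_mismatch[OF less.prems, of _ k] by (simp add: c_def)
      then show ?thesis using False 0 bv fibs by (intro exI[of _ "fib (k + 4) - 1"]) auto
    qed
  qed
qed

lemma expand_level:
  assumes "golden x"
  shows "\<exists>v. x = sdrop v (expand k (level x k)) \<and>
    v + offset x k = (if symb (level x k) = Case_iii then fib (k + 1) else fib (k + 2))"
proof -
  define z where "z = level x k"
  obtain V where V: "blk k (shd z) = V @ lead x k" "x = lead x k @- expand k (stl z)"
    using lead_decomposition[OF assms, of k] by (auto simp: suffix_def z_def)
  have "z = shd z ## stl z" by simp
  then have "expand k z = blk k (shd z) @- expand k (stl z)" by (metis expand_SCons)
  also have "\<dots> = V @- x" unfolding V(1) using V(2) by simp
  finally have "x = sdrop (length V) (expand k z)" by (simp add: sdrop_shift)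
  moreover have "length V + offset x k = length (blk k (shd z))" by (simp add: V(1) offset_def)
  moreover have "\<dots> = (if symb z = Case_iii then fib (k + 1) else fib (k + 2))"
    using golden_shd[OF golden_level[OF assms], of k]
    by (auto simp: blk_def length_M symb_def z_def[symmetric])
  ultimately show ?thesis unfolding z_def by metis
qed

lemma obtain_fib_interval:
  assumes "0 < p"
  obtains k where "fib (k + 2) \<le> p" "p < fib (k + 3)"
proof -
  have "\<exists>k. fib (k + 2) \<le> p \<and> p < fib (k + 3)"
    using assms
  proof (induction p)
    case (Suc p)
    show ?case
    proof (cases "p = 0")
      case True
      then show ?thesis by (intro exI[of _ 0]) (simp add: numeral_eq_Suc)
    next
      case False
      then obtain k where k: "fib (k + 2) \<le> p" "p < fib (k + 3)" using Suc by auto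
      have "fib (Suc k + 2) = fib (k + 3)" "fib (k + 3) < fib (Suc k + 3)"
        using fib_neq_0_nat[of "k + 2"] by (simp_all add: numeral_eq_Suc)
      then show ?thesis using k by (cases "Suc p < fib (k + 3)") (metis Suc_leI le_SucI less_antisym le_eq_less_or_eq)+
    qed
  qed simp
  then show ?thesis using that by blast
qed

text \<open>A match that is short relative to its shift satisfies the first alternative. Otherwise
  the shift is a Fibonacci number, and the match stops at a mismatch near a block end. The first two
  alternatives make \<open>q\<close> at least about \<phi>n whatever \<open>W\<close> is; the last
  two are where \<open>|W|\<close> enters.\<close>

lemma match_bounds:
  assumes "golden x" "j < q" "matches x j q n"
  obtains k where "n \<le> fib (k + 4)" "fib (k + 2) \<le> q" "n \<le> fib (k + 3)"
    | k where "n \<le> fib (k + 4)" "fib (k + 4) \<le> q + 1"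
    | k where "n \<le> fib (k + 4)" "symb (level x (Suc k)) = Case_ii" "fib (k + 2) + offset x (Suc k) \<le> q + 1"
    | k where "n \<le> fib (k + 4)" "symb (level x (Suc k)) = Case_iii" "fib (k + 2) \<le> q"
        "n \<le> offset x (Suc k) + fib (k + 3)"
proof -
  define p where "p = q - j"
  have q: "q = j + p" and p0: "0 < p" using assms(2) by (simp_all add: p_def)
  obtain k where k: "fib (k + 2) \<le> p" "p < fib (k + 3)" using obtain_fib_interval[OF p0] by blast
  have fibs: "fib (k + 4) = fib (k + 3) + fib (k + 2)" "fib (k + 2) > 0" "fib (k + 3) \<ge> 2"
    using fib_mono[of 3 "k + 3"] fib_neq_0_nat[of "k + 2"] by (simp_all add: numeral_eq_Suc)
  show ?thesis
  proof (cases "fib (k + 3) \<le> n + 1")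
    case False
    then show ?thesis using fibs k q by (intro that(1)[of k]) linarith+
  next
    case True
    have p: "p = fib (k + 2)"
      using match_shift_fib[OF assms(1), of j p n "Suc k"] assms(3) q p0 k(2) True
      by (simp add: numeral_eq_Suc)
    define w where "w = offset x (Suc k)"
    define z where "z = level x (Suc k)"
    define Y where "Y = expand (Suc k) z"
    have g: "golden z" unfolding z_def by (rule golden_level[OF assms(1)])
    obtain v where v: "x = sdrop v Y"
      "v + w = (if symb z = Case_iii then fib (k + 2) else fib (k + 3))"
      using expand_level[OF assms(1), of "Suc k"] unfolding Y_def z_def w_def
      by (auto simp del: level.simps fib.simps simp: numeral_eq_Suc)
    have w0: "0 < w" unfolding w_def by (rule offset_pos[OF assms(1)])
    \<comment> \<open>A match starting at \<open>j\<close> cannot cross a mismatch at or behind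
      \<open>j\<close>; \<open>v\<close> translates positions of \<open>x\<close> into positions of
      \<open>Y\<close>.\<close>
    have block: "j + n \<le> i" if "Y !! (v + i) \<noteq> Y !! (fib (k + 2) + (v + i))" "j \<le> i" for i
    proof (rule ccontr)
      assume "\<not> j + n \<le> i"
      then have "i - j < n" using that(2) by linarith
      then have "x !! (j + (i - j)) = x !! (j + p + (i - j))" using assms(3) q unfolding matches_def by blast
      then have "x !! i = x !! (p + i)" using that(2) by (simp add: add.commute add.left_commute)
      then have "Y !! (v + i) = Y !! (v + (p + i))" by (simp add: v(1) sdrop_snth)
      then show False using that(1) p by (simp add: add.left_commute)
    qed
    obtain i where i: "v + j \<le> i" "i < v + j + fib (k + 4)" "Y !! i \<noteq> Y !! (fib (k + 2) + i)"
      using expand_mismatch_within[OF g] unfolding Y_def by blast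
    have "j + n \<le> i - v" using block[of "i - v"] i by (simp add: le_diff_conv2 del: fib.simps)
    then have n: "n \<le> fib (k + 4)" using i by linarith
    show ?thesis
    proof (cases "symb z")
      case Case_iii
      then have s: "shd z = 0" by (auto simp: symb_def split: if_splits)
      have "v + (w + fib (k + 3) - 2) = fib (k + 4) - 2" using v(2) Case_iii fibs by simp
      then have m: "Y !! (v + (w + fib (k + 3) - 2)) \<noteq> Y !! (fib (k + 2) + (v + (w + fib (k + 3) - 2)))"
        using expand_0_1_mismatch[OF g s] unfolding Y_def by simp
      show ?thesis
      proof (cases "j \<le> w + fib (k + 3) - 2")
        case True
        have "n \<le> offset x (Suc k) + fib (k + 3)" using block[OF m True] w_def by linarith
        moreover have "fib (k + 2) \<le> q" using q k by linarith
        ultimately show ?thesis using that(4)[of k] n Case_iii z_def by blast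
      next
        case False
        then have "fib (k + 4) \<le> q + 1" using q p fibs w0 by linarith
        then show ?thesis using that(2) n by blast
      qed
    next
      case Case_ii
      then have s: "shd z = 1" using golden_shd[OF g] by (auto simp: symb_def)
      show ?thesis
      proof (cases "j + 2 \<le> w")
        case True
        then have "v + (w - 2) = fib (k + 3) - 2" using v(2) Case_ii by simp
        then have m: "Y !! (v + (w - 2)) \<noteq> Y !! (fib (k + 2) + (v + (w - 2)))"
          using expand_1_mismatch[OF g s] unfolding Y_def by simp
        have "j + n \<le> w - 2" using True by (intro block[OF m]) linarith
        moreover have "w \<le> fib (k + 3)" using v(2) Case_ii by simp
        ultimately show ?thesis using n q k by (intro that(1)[of k]) linarith+
      next
        \<comment> \<open>The end of the first block does not stop this match, but its start is
          late, which bounds \<open>q\<close> from below by the shift plus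
          \<open>|W|\<close>.\<close>
        case False
        then have "fib (k + 2) + offset x (Suc k) \<le> q + 1" using q p w_def by linarith
        then show ?thesis using that(3)[of k] n Case_ii z_def by blast
      qed
    next
      case Case_i
      then have s: "shd z = 1" using golden_shd[OF g] by (auto simp: symb_def split: if_splits)
      have s': "shd (stl z) = 1" using golden_shd[OF golden_stl[OF g]] Case_i by (auto simp: symb_def split: if_splits)
      show ?thesis
      proof (cases "j + 2 \<le> w")
        case True
        then have "v + (w - 2) = fib (k + 3) - 2" using v(2) Case_i by simp
        then have m: "Y !! (v + (w - 2)) \<noteq> Y !! (fib (k + 2) + (v + (w - 2)))"
          using expand_1_mismatch[OF g s] unfolding Y_def by simp
        have "j + n \<le> w - 2" using True by (intro block[OF m]) linarith
        moreover have "w \<le> fib (k + 3)" using v(2) Case_i by simp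
        ultimately show ?thesis using n q k by (intro that(1)[of k]) linarith+
      next
        \<comment> \<open>The start lies past the mismatches of the first block, up to one letter.
          The second block also belongs to a 1, and the mismatch near its end takes over.\<close>
        case F: False
        have z: "z = 1 ## stl z" using s by (metis stream.collapse)
        have e: "Y = M (Suc (Suc k)) @- expand (Suc k) (stl z)"
          unfolding Y_def by (subst z, subst expand_SCons) (simp add: blk_def)
        have l: "length (M (Suc (Suc k))) = fib (k + 3)" by (simp only: length_M) (simp add: numeral_3_eq_3)
        have sh: "Y !! (fib (k + 3) + i) = expand (Suc k) (stl z) !! i" for i
          unfolding e by (simp only: shift_snth l) simp
        have "expand (Suc k) (stl z) !! (fib (k + 3) - 2) \<noteq> expand (Suc k) (stl z) !! (fib (k + 2) + (fib (k + 3) - 2))"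
          using expand_1_mismatch[OF golden_stl[OF g] s'] by simp
        then have "Y !! (fib (k + 3) + (fib (k + 3) - 2)) \<noteq> Y !! (fib (k + 2) + (fib (k + 3) + (fib (k + 3) - 2)))"
          using sh[of "fib (k + 3) - 2"] sh[of "fib (k + 2) + (fib (k + 3) - 2)"] by (metis add.left_commute)
        moreover have "v + (w + (fib (k + 3) - 2)) = fib (k + 3) + (fib (k + 3) - 2)" using v(2) Case_i by simp
        ultimately have m: "Y !! (v + (w + (fib (k + 3) - 2))) \<noteq> Y !! (fib (k + 2) + (v + (w + (fib (k + 3) - 2))))"
          by metis
        show ?thesis
        proof (cases "j \<le> w + (fib (k + 3) - 2)")
          case True
          then have "n \<le> fib (k + 3)" using block[OF m True] F fibs by linarith
          then show ?thesis using n q k by (intro that(1)[of k]) linarith+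
        next
          case False
          then have "fib (k + 4) \<le> q + 1" using q p fibs w0 by linarith
          then show ?thesis using that(2) n by blast
        qed
      qed
    qed
  qed
qed

section \<open>Bounds on the repetition exponent from the locating chain\<close>

lemma golden_slope_power_le_1: "golden_slope ^ m \<le> 1"
  using golden_slope_bounds by (intro power_le_one) auto

lemma fib_approx: "\<bar>real (fib m) - golden_slope * real (fib (m + 1))\<bar> \<le> 1"
proof -
  have "real (fib m) - golden_slope * real (fib (m + 1)) = - ((-1) ^ m * golden_slope ^ Suc m)"
    using fib_golden_slope[of m] by (metis Suc_eq_plus1 minus_diff_eq mult.commute)
  then have "\<bar>real (fib m) - golden_slope * real (fib (m + 1))\<bar> = \<bar>golden_slope ^ Suc m\<bar>"
    by (simp only: abs_minus_cancel abs_mult power_abs abs_1 power_one mult_1_left)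
  then show ?thesis using golden_slope_power_le_1[of "Suc m"] golden_slope_bounds by simp
qed

lemma fib_approx2: "\<bar>real (fib m) - golden_slope ^ 2 * real (fib (m + 2))\<bar> \<le> 2"
proof -
  have "\<bar>golden_slope * (real (fib (m + 1)) - golden_slope * real (fib (m + 2)))\<bar> \<le> 1 * 1"
    unfolding abs_mult using fib_approx[of "m + 1"] golden_slope_bounds by (intro mult_mono) auto
  then show ?thesis using fib_approx[of m] by (simp add: algebra_simps power2_eq_square)
qed

lemma le_fib_Suc: "n \<le> fib (Suc n)"
proof (induction n rule: fib.induct)
  case (3 n)
  then show ?case using fib_neq_0_nat[of "Suc n"] by simp
qed simp_all

lemma power2_fib_le: "2 ^ d * fib n \<le> fib (n + 2 * d)"
proof (induction d)
  case (Suc d)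
  have "2 * fib (n + 2 * d) \<le> fib (n + 2 * Suc d)" using fib_Suc_mono[of "n + 2 * d"] by simp
  then show ?case using Suc by simp
qed simp

lemma fib_add_le: "0 < n \<Longrightarrow> fib (n + d) \<le> 2 ^ d * fib n"
proof (induction d)
  case (Suc d)
  obtain m where "n + d = Suc m" using Suc.prems by (cases "n + d") auto
  then have "fib (n + Suc d) \<le> 2 * fib (n + d)" using fib_Suc_mono[of m] by simp
  then show ?case using Suc by simp
qed simp

lemma offset_mono: "m \<le> k \<Longrightarrow> offset x m \<le> offset x k"
  by (induction k) (auto simp: offset_Suc le_Suc_eq)

lemma offset_Case_ii_run:
  "(\<And>i. i < l \<Longrightarrow> symb (level x (m + i)) = Case_ii) \<Longrightarrow>
    offset x (m + l) + fib (m + 2) = offset x m + fib (m + l + 2)"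
  by (induction l) (simp_all add: offset_Suc del: level.simps)

lemma offset_no_Case_ii_run:
  "(\<And>i. i < l \<Longrightarrow> symb (level x (m + i)) \<noteq> Case_ii) \<Longrightarrow> offset x (m + l) = offset x m"
  by (induction l) (simp_all add: offset_Suc del: level.simps)

text \<open>High levels supply arbitrarily long matches: (ii) and (iii) directly, and (i) through
  the (iii) that follows it.\<close>

lemma exists_match:
  assumes "golden x" shows "\<exists>j q. j < q \<and> matches x j q n"
proof -
  have iii: "\<exists>j q. j < q \<and> matches x j q n" if "symb (level x (Suc k)) = Case_iii" "n \<le> k" for k
  proof -
    have "n \<le> offset x (Suc k) + fib (k + 3) - 2"
      using that(2) le_fib_Suc[of "k + 2"] by (simp add: numeral_3_eq_3)
    then have "matches x 0 (fib (k + 2)) n" by (rule matches_mono[OF match_Case_iii[OF assms that(1)]])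
    moreover have "0 < fib (k + 2)" by (rule fib_neq_0_nat) simp
    ultimately show ?thesis by blast
  qed
  show ?thesis
  proof (cases "symb (level x (Suc n))")
    case Case_i
    then show ?thesis using iii[of "Suc n"] symb_level_Suc[OF assms] by (meson le_SucI order_refl)
  next
    case Case_ii
    have "n \<le> fib (Suc n + 3) - 2" using le_fib_Suc[of "n + 3"] by (simp add: numeral_3_eq_3)
    then have "matches x (offset x (Suc n)) (offset x (Suc n) + fib (Suc n + 1)) n"
      by (rule matches_mono[OF match_Case_ii[OF assms Case_ii]])
    moreover have "0 < fib (Suc n + 1)" by (rule fib_neq_0_nat) simp
    then have "offset x (Suc n) < offset x (Suc n) + fib (Suc n + 1)" by linarith
    ultimately show ?thesis by blast
  next
    case Case_iii
    then show ?thesis using iii by simp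
  qed
qed

text \<open>Since \<open>\<alpha> \<le> golden_slope\<close>, the alternatives of
  \<open>match_bounds\<close> that ignore \<open>W\<close> always comply. A lower bound thus reduces
  to one inequality at each (ii) and one at each (iii).\<close>

lemma rep_geI_levels:
  assumes "golden x" "0 \<le> \<alpha>" "\<alpha> \<le> golden_slope" "1 \<le> C"
    and ii: "\<And>k. K \<le> k \<Longrightarrow> symb (level x k) = Case_ii \<Longrightarrow>
      \<alpha> * real (fib (k + 3)) - C \<le> real (fib (k + 1)) + real (offset x k)"
    and iii: "\<And>k. K \<le> k \<Longrightarrow> symb (level x k) = Case_iii \<Longrightarrow>
      \<alpha> * (real (offset x k) + real (fib (k + 2))) - C \<le> real (fib (k + 1))"
  shows "ereal (1 + \<alpha>) \<le> rep x"
proof (rule rep_geI[of x "Suc (fib (K + 4))" \<alpha> "C + 1"])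
  show "\<exists>j q. j < q \<and> matches x j q n" for n by (rule exists_match[OF assms(1)])
next
  fix n j q assume N: "Suc (fib (K + 4)) \<le> n" and jq: "j < q" "matches x j q n"
  \<comment> \<open>A length above \<open>fib (K + 4)\<close> forces the level supplied by
    \<open>match_bounds\<close> past \<open>K\<close>.\<close>
  have K: "K \<le> k" if "n \<le> fib (k + 4)" for k
  proof (rule ccontr)
    assume "\<not> K \<le> k"
    then have "fib (k + 4) \<le> fib (K + 4)" by (intro fib_mono) simp
    then show False using N that by linarith
  qed
  have n: "\<alpha> * real n \<le> \<alpha> * real m" if "n \<le> m" for m
    using that assms(2) by (intro mult_left_mono) auto
  from assms(1) jq show "\<alpha> * real n - (C + 1) \<le> real q"
  proof (cases rule: match_bounds)
    case (1 k)
    have "\<alpha> * real n \<le> \<alpha> * real (fib (k + 3))" using n 1(3) by blast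
    also have "\<dots> \<le> golden_slope * real (fib (k + 3))" using assms(3) by (intro mult_right_mono) auto
    also have "\<dots> \<le> real (fib (k + 2)) + 1" using fib_approx[of "k + 2"] by (simp add: numeral_eq_Suc abs_le_iff)
    also have "\<dots> \<le> real q + 1" using 1(2) by linarith
    finally show ?thesis using assms(4) by linarith
  next
    case (2 k)
    have "\<alpha> * real n \<le> 1 * real (fib (k + 4))" using 2(1) assms(2,3) golden_slope_bounds
      by (intro mult_mono) auto
    then show ?thesis using 2(2) assms(4) by linarith
  next
    case (3 k)
    have "\<alpha> * real n \<le> \<alpha> * real (fib (k + 4))" using n 3(1) by blast
    moreover have "\<alpha> * real (fib (Suc k + 3)) - C \<le> real (fib (Suc k + 1)) + real (offset x (Suc k))"
      using ii[of "Suc k"] K[OF 3(1)] 3(2) by simp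
    moreover have "real (fib (Suc k + 1)) + real (offset x (Suc k)) \<le> real q + 1"
      using 3(3) by (simp add: algebra_simps)
    ultimately show ?thesis by (simp add: numeral_eq_Suc)
  next
    case (4 k)
    have "\<alpha> * real n \<le> \<alpha> * real (offset x (Suc k) + fib (k + 3))" using n 4(4) by blast
    moreover have "\<alpha> * (real (offset x (Suc k)) + real (fib (Suc k + 2))) - C \<le> real (fib (Suc k + 1))"
      using iii[of "Suc k"] K[OF 4(1)] 4(2) by simp
    ultimately show ?thesis using 4(3) by (simp add: numeral_eq_Suc)
  qed
qed

text \<open>At (ii) the bound \<open>|W| \<ge> 0\<close> suffices, at (iii) the bound by the block
  length. Both extremes lead to the ratio of \<open>fib (k + 1)\<close> to
  \<open>fib (k + 3)\<close>, which tends to \<phi>^2.\<close>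

lemma rep_ge_min:
  assumes "golden x" shows "ereal mu_min \<le> rep x"
  unfolding mu_min_def
proof (rule rep_geI_levels[OF assms, where C = 2 and K = 0])
  show "golden_slope\<^sup>2 \<le> golden_slope" unfolding golden_slope_square using golden_slope_bounds by simp
  have lo: "golden_slope\<^sup>2 * real (fib (k + 3)) - 2 \<le> real (fib (k + 1))" for k
    using fib_approx2[of "k + 1"] by (simp add: numeral_3_eq_3)
  show "golden_slope\<^sup>2 * real (fib (k + 3)) - 2 \<le> real (fib (k + 1)) + real (offset x k)" for k
    using lo[of k] by linarith
  fix k assume "symb (level x k) = Case_iii"
  then have "offset x k + fib (k + 2) \<le> fib (k + 3)"
    using offset_le[OF assms, of k] by (simp add: numeral_3_eq_3)
  then have "golden_slope\<^sup>2 * (real (offset x k) + real (fib (k + 2))) \<le> golden_slope\<^sup>2 * real (fib (k + 3))"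
    by (intro mult_left_mono) (linarith | simp)+
  then show "golden_slope\<^sup>2 * (real (offset x k) + real (fib (k + 2))) - 2 \<le> real (fib (k + 1))"
    using lo[of k] by linarith
qed auto

text \<open>Infinitely many (iii) give matches with shift \<open>fib (k + 2)\<close> and length at
  least \<open>fib (k + 3) - 2\<close>. If only (ii) occurs from some level on, \<open>W\<close> is
  nearly a whole block and the match at the start of the word gives the same ratio.\<close>

lemma rep_le_max:
  assumes "golden x" shows "rep x \<le> ereal mu_max"
proof (cases "\<exists>K. \<forall>k\<ge>K. symb (level x k) = Case_ii")
  case True
  then obtain K where K: "\<And>k. K \<le> k \<Longrightarrow> symb (level x k) = Case_ii" by blast
  show ?thesis unfolding mu_max_def
  proof (rule rep_leI[of x golden_slope "real (fib (K + 2)) + 3"])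
    fix N
    \<comment> \<open>The summands keep \<open>offset x (Suc k)\<close> at least
      \<open>N + 2\<close> despite the loss \<open>fib (K + 2)\<close>.\<close>
    define k where "k = K + N + fib (K + 2) + 2"
    have k: "K \<le> Suc k" by (simp add: k_def)
    have "offset x (K + (Suc k - K)) + fib (K + 2) = offset x K + fib (K + (Suc k - K) + 2)"
      by (rule offset_Case_ii_run) (simp add: K)
    then have off: "fib (k + 3) \<le> offset x (Suc k) + fib (K + 2)" using k by (simp add: numeral_3_eq_3)
    moreover have "k + 2 \<le> fib (k + 3)" using le_fib_Suc[of "k + 2"] by (simp add: numeral_3_eq_3)
    ultimately have n: "N + 2 \<le> offset x (Suc k)" unfolding k_def by linarith
    have "real (fib (k + 2)) \<le> golden_slope * real (fib (k + 3)) + 1"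
      using fib_approx[of "k + 2"] by (simp add: numeral_3_eq_3)
    also have "golden_slope * real (fib (k + 3)) \<le> golden_slope * (real (offset x (Suc k) - 2) + 2 + real (fib (K + 2)))"
      using off n golden_slope_bounds by (intro mult_left_mono) auto
    also have "\<dots> \<le> golden_slope * real (offset x (Suc k) - 2) + 1 * (2 + real (fib (K + 2)))"
      unfolding distrib_left add.assoc using golden_slope_bounds
      by (intro add_left_mono add_mono mult_right_mono) auto
    finally have "real (fib (k + 2)) \<le> golden_slope * real (offset x (Suc k) - 2) + (real (fib (K + 2)) + 3)" by simp
    moreover have "0 < fib (k + 2)" using fib_neq_0_nat[of "k + 2"] by simp
    moreover have "matches x 0 (fib (k + 2)) (offset x (Suc k) - 2)"
      using match_Case_ii_start[OF assms K[OF k]] .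
    ultimately show "\<exists>n\<ge>N. \<exists>j q. j < q \<and> matches x j q n \<and> real q \<le> golden_slope * real n + (real (fib (K + 2)) + 3)"
      using n by (intro exI[of _ "offset x (Suc k) - 2"] exI[of _ 0] exI[of _ "fib (k + 2)"] conjI) linarith+
  qed
next
  case False
  show ?thesis unfolding mu_max_def
  proof (rule rep_leI[of x golden_slope 3])
    fix N
    obtain k' where k': "k' \<ge> N + 2" "symb (level x k') \<noteq> Case_ii" using False by blast
    have "\<exists>k\<ge>N. symb (level x (Suc k)) = Case_iii"
    proof (cases "symb (level x k')")
      case Case_i
      then show ?thesis using symb_level_Suc[OF assms, of k'] k' by (intro exI[of _ k']) simp
    next
      case Case_iii
      then show ?thesis using k' by (intro exI[of _ "k' - 1"]) (auto simp del: level.simps)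
    qed (use k' in simp)
    then obtain k where k: "N \<le> k" "symb (level x (Suc k)) = Case_iii" by blast
    define n where "n = offset x (Suc k) + fib (k + 3) - 2"
    have "k + 2 \<le> fib (k + 3)" using le_fib_Suc[of "k + 2"] by (simp add: numeral_3_eq_3)
    then have n: "N \<le> n" "fib (k + 3) \<le> n + 2" using k unfolding n_def by linarith+
    have pos: "0 < fib (k + 2)" by (rule fib_neq_0_nat) simp
    have "real (fib (k + 2)) \<le> golden_slope * real (fib (k + 3)) + 1"
      using fib_approx[of "k + 2"] by (simp add: numeral_3_eq_3)
    also have "golden_slope * real (fib (k + 3)) \<le> golden_slope * (real n + 2)"
      using n(2) golden_slope_bounds by (intro mult_left_mono) auto
    finally have "real (fib (k + 2)) \<le> golden_slope * real n + 3"
      using golden_slope_bounds by (simp add: algebra_simps)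
    then show "\<exists>n\<ge>N. \<exists>j q. j < q \<and> matches x j q n \<and> real q \<le> golden_slope * real n + 3"
      using n(1) match_Case_iii[OF assms k(2)] pos unfolding n_def[symmetric] by blast
  qed
qed

text \<open>Here \<open>|W|\<close> is \<open>fib (k + 2)\<close> up to a constant, so a match
  starting behind \<open>W\<close> has \<open>q\<close> close to \<open>fib (k + 3)\<close>.\<close>

lemma rep_eq_max_if_ultimately_Case_ii:
  assumes "golden x" "\<And>k. K \<le> k \<Longrightarrow> symb (level x k) = Case_ii"
  shows "ereal mu_max \<le> rep x"
  unfolding mu_max_def
proof (rule rep_geI_levels[OF assms(1), where C = "1 + real (fib (K + 2))" and K = K])
  fix k assume k: "K \<le> k"
  have "offset x (K + (k - K)) + fib (K + 2) = offset x K + fib (K + (k - K) + 2)"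
    by (rule offset_Case_ii_run) (simp add: assms(2))
  then have "fib (k + 3) \<le> fib (k + 1) + offset x k + fib (K + 2)" using k by (simp add: numeral_3_eq_3)
  moreover have "golden_slope * real (fib (k + 3)) \<le> 1 * real (fib (k + 3))"
    using golden_slope_bounds by (intro mult_right_mono) auto
  ultimately show "golden_slope * real (fib (k + 3)) - (1 + real (fib (K + 2))) \<le> real (fib (k + 1)) + real (offset x k)"
    by linarith
next
  fix k assume "K \<le> k" "symb (level x k) = Case_iii"
  then show "golden_slope * (real (offset x k) + real (fib (k + 2))) - (1 + real (fib (K + 2))) \<le> real (fib (k + 1))"
    using assms(2)[of k] by simp
qed (use golden_slope_bounds in auto)

text \<open>Here \<open>|W|\<close> stops growing, so at (iii) the match length is
  \<open>fib (k + 2)\<close> up to a constant, against the shift \<open>fib (k + 1)\<close>.\<close>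

lemma rep_eq_max_if_ultimately_no_Case_ii:
  assumes "golden x" "\<And>k. K \<le> k \<Longrightarrow> symb (level x k) \<noteq> Case_ii"
  shows "ereal mu_max \<le> rep x"
  unfolding mu_max_def
proof (rule rep_geI_levels[OF assms(1), where C = "1 + real (offset x K)" and K = K])
  fix k assume k: "K \<le> k"
  have "offset x (K + (k - K)) = offset x K"
    by (rule offset_no_Case_ii_run) (simp add: assms(2))
  then have o: "offset x k = offset x K" using k by simp
  have "golden_slope * real (offset x K) \<le> 1 * real (offset x K)"
    using golden_slope_bounds by (intro mult_right_mono) auto
  moreover have "golden_slope * real (fib (k + 2)) \<le> real (fib (k + 1)) + 1"
    using fib_approx[of "k + 1"] by simp
  ultimately show "golden_slope * (real (offset x k) + real (fib (k + 2))) - (1 + real (offset x K)) \<le> real (fib (k + 1))"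
    unfolding o distrib_left by linarith
next
  fix k assume "K \<le> k" "symb (level x k) = Case_ii"
  then show "golden_slope * real (fib (k + 3)) - (1 + real (offset x K)) \<le> real (fib (k + 1)) + real (offset x k)"
    using assms(2)[of k] by simp
qed (use golden_slope_bounds in auto)

text \<open>Infinitely often (ii) is followed by (i) and (iii). The growth of \<open>W\<close> at
  that (ii) makes the match at the (iii) twice as long as its shift up to a constant, which gives
  3/2 < 1 + \<phi>.\<close>

lemma rep_less_max_if_mixed:
  assumes "golden x" "\<And>K. \<exists>k\<ge>K. symb (level x k) = Case_ii" "\<And>K. \<exists>k\<ge>K. symb (level x k) \<noteq> Case_ii"
  shows "rep x < ereal mu_max"
proof -
  have "rep x \<le> ereal (1 + 1/2)"
  proof (rule rep_leI[of x "1/2" 1])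
    fix N
    obtain k0 where k0: "N \<le> k0" "symb (level x k0) = Case_ii" using assms(2) by blast
    define k2 where "k2 = (LEAST k. k0 \<le> k \<and> symb (level x k) \<noteq> Case_ii)"
    have k2: "k0 \<le> k2 \<and> symb (level x k2) \<noteq> Case_ii"
      unfolding k2_def by (rule LeastI_ex) (use assms(3)[of k0] in blast)
    then obtain k where k: "k2 = Suc k" "k0 \<le> k" using k0 by (metis le_SucE not0_implies_Suc le_zero_eq)
    have ii: "symb (level x k) = Case_ii"
      using not_less_Least[of k "\<lambda>k. k0 \<le> k \<and> symb (level x k) \<noteq> Case_ii"] k unfolding k2_def by auto
    \<comment> \<open>A (iii) cannot follow (ii), so the first symbol other than (ii) is
      (i).\<close>
    then have i: "symb (level x (Suc k)) = Case_i"
      using k2 k(1) symb_level_Suc[OF assms(1), of k] by (cases "symb (level x (Suc k))") auto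
    then have iii: "symb (level x (Suc (Suc k))) = Case_iii"
      using symb_level_Suc[OF assms(1), of "Suc k"] by simp
    have off: "offset x (Suc (Suc k)) = offset x k + fib (k + 1)"
      unfolding offset_Suc ii i by simp
    define n where "n = offset x (Suc (Suc k)) + fib (Suc k + 3) - 2"
    have "Suc k + 3 = k + 2 + 2" "Suc k + 2 = k + 2 + 1" by simp_all
    then have "fib (Suc k + 3) = fib (Suc k + 2) + fib (k + 2)" by (simp only: fib_plus_2)
    moreover have "fib (Suc k + 2) = fib (k + 2) + fib (k + 1)" by simp
    ultimately have "2 * fib (Suc k + 2) \<le> n + 2" unfolding n_def off by linarith
    then have "real (fib (Suc k + 2)) \<le> 1 / 2 * real n + 1" by linarith
    moreover have "k + 3 \<le> fib (Suc k + 3)" using le_fib_Suc[of "k + 3"] by (simp add: numeral_3_eq_3)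
    then have "N \<le> n" using k0 k unfolding n_def by linarith
    moreover have "0 < fib (Suc k + 2)" by (rule fib_neq_0_nat) simp
    moreover have "matches x 0 (fib (Suc k + 2)) n" unfolding n_def by (rule match_Case_iii[OF assms(1) iii])
    ultimately show "\<exists>n\<ge>N. \<exists>j q. j < q \<and> matches x j q n \<and> real q \<le> 1 / 2 * real n + 1" by blast
  qed
  also have "\<dots> < ereal mu_max" using golden_slope_bounds by (simp add: mu_max_def)
  finally show ?thesis .
qed

section \<open>Chains in the locating chain\<close>

declare level.simps [simp del] lead.simps [simp del]

lemma sdrop_eq_shift_iff:
  "(\<exists>y. sdrop p s = u @- y) \<longleftrightarrow> (\<forall>i<length u. s !! (p + i) = u ! i)"
proof
  assume "\<forall>i<length u. s !! (p + i) = u ! i"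
  then have "stake (length u) (sdrop p s) = u" by (intro nth_equalityI) (auto simp: sdrop_snth)
  then show "\<exists>y. sdrop p s = u @- y" by (metis stake_sdrop)
next
  assume "\<exists>y. sdrop p s = u @- y"
  then obtain y where y: "sdrop p s = u @- y" by blast
  have "sdrop p s !! i = u ! i" if "i < length u" for i unfolding y using that by simp
  then show "\<forall>i<length u. s !! (p + i) = u ! i" by (simp add: sdrop_snth)
qed

lemma length_concat_replicate_block_a: "length (concat (replicate l block_a)) = 2 * l"
  by (induction l) (simp_all add: block_a_def)

lemma nth_concat_replicate_block_a:
  "i < 2 * l \<Longrightarrow> concat (replicate l block_a) ! i = (if even i then Case_i else Case_iii)"
proof (induction l arbitrary: i)
  case (Suc l)
  show ?case
  proof (cases "i < 2")
    case True
    then have "i = 0 \<or> i = 1" by linarith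
    then show ?thesis by (auto simp: block_a_def)
  next
    case False
    then obtain i' where i': "i = Suc (Suc i')" by (metis add_2_eq_Suc' le_Suc_ex linorder_not_less add.commute)
    then show ?thesis using Suc by (simp add: block_a_def)
  qed
qed simp

lemma concat_replicate_block_b: "concat (replicate l block_b) = replicate l Case_ii"
  by (induction l) (simp_all add: block_b_def)

lemma a_chain_at_iff:
  assumes "golden x"
  shows "a_chain_at (locating_chain x) p l \<longleftrightarrow> 1 \<le> l \<and> symb (level x p) = Case_ii \<and>
    (\<forall>i<2 * l. symb (level x (p + 1 + i)) = (if even i then Case_i else Case_iii)) \<and>
    symb (level x (p + 1 + 2 * l)) = Case_ii"
proof -
  define u where "u = block_b @ concat (replicate l block_a) @ block_b"
  have len: "length u = Suc (2 * l + 1)"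
    by (simp add: u_def length_concat_replicate_block_a block_b_def)
  have u: "u ! 0 = Case_ii" "u ! Suc (2 * l) = Case_ii"
    "i < 2 * l \<Longrightarrow> u ! Suc i = (if even i then Case_i else Case_iii)" for i
    by (simp_all add: u_def block_b_def nth_append length_concat_replicate_block_a nth_concat_replicate_block_a)
  have "(\<exists>y. sdrop p (locating_chain x) = u @- y) \<longleftrightarrow> (\<forall>i<length u. symb (level x (p + i)) = u ! i)"
    unfolding sdrop_eq_shift_iff locating_chain_nth[OF assms] ..
  also have "\<dots> \<longleftrightarrow> symb (level x p) = Case_ii \<and> (\<forall>i<2 * l + 1. symb (level x (p + 1 + i)) = u ! Suc i)"
    unfolding len All_less_Suc2 u(1) by simp
  also have "\<dots> \<longleftrightarrow> symb (level x p) = Case_ii \<and>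
    (\<forall>i<2 * l. symb (level x (p + 1 + i)) = (if even i then Case_i else Case_iii)) \<and>
    symb (level x (p + 1 + 2 * l)) = Case_ii"
    using u(2,3) by (auto simp: less_Suc_eq)
  finally show ?thesis unfolding a_chain_at_def u_def by blast
qed

lemma b_chain_at_iff:
  assumes "golden x"
  shows "b_chain_at (locating_chain x) p l \<longleftrightarrow> 1 \<le> l \<and> symb (level x p) = Case_i \<and>
    (\<forall>i<l. symb (level x (p + 2 + i)) = Case_ii) \<and> symb (level x (p + 2 + l)) = Case_i"
proof -
  define u where "u = block_a @ concat (replicate l block_b) @ block_a"
  have len: "length u = Suc (Suc (Suc (Suc l)))"
    by (simp add: u_def concat_replicate_block_b block_a_def)
  have u: "u ! 0 = Case_i" "u ! Suc 0 = Case_iii" "u ! Suc (Suc l) = Case_i" "u ! Suc (Suc (Suc l)) = Case_iii"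
    "i < l \<Longrightarrow> u ! Suc (Suc i) = Case_ii" for i
    by (simp_all add: u_def block_a_def nth_append concat_replicate_block_b)
  have "(\<exists>y. sdrop p (locating_chain x) = u @- y) \<longleftrightarrow> (\<forall>i<length u. symb (level x (p + i)) = u ! i)"
    unfolding sdrop_eq_shift_iff locating_chain_nth[OF assms] ..
  also have "\<dots> \<longleftrightarrow> symb (level x p) = Case_i \<and> symb (level x (Suc p)) = Case_iii \<and>
    (\<forall>i<Suc (Suc l). symb (level x (p + 2 + i)) = u ! Suc (Suc i))"
    unfolding len All_less_Suc2 u(1,2) by simp
  also have "\<dots> \<longleftrightarrow> symb (level x p) = Case_i \<and> symb (level x (Suc p)) = Case_iii \<and>
    (\<forall>i<l. symb (level x (p + 2 + i)) = Case_ii) \<and> symb (level x (p + 2 + l)) = Case_i \<and>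
    symb (level x (Suc (p + 2 + l))) = Case_iii"
    using u(3,4,5) by (auto simp: less_Suc_eq)
  finally show ?thesis unfolding b_chain_at_def u_def symb_level_Suc[OF assms] by blast
qed

text \<open>A long \<open>a\<close>-chain leaves \<open>|W|\<close> unchanged, hence negligible at
  the (ii) behind it. A long \<open>b\<close>-chain fills \<open>W\<close> up to nearly the whole
  block, which the following (iii) exploits. Both give ratios close to \<phi>^2.\<close>

lemma rep_le_min_if_long_chains:
  assumes "sturmian golden_slope x" "\<forall>d\<ge>1. x \<in> S d"
  shows "rep x \<le> ereal mu_min"
proof -
  have g: "golden x" using assms(1) by (rule sturmian_imp_golden)
  have *: "rep x \<le> ereal (1 + (golden_slope\<^sup>2 + (1/2) ^ e))" if "1 \<le> e" for e :: nat
  proof (rule rep_leI[of x _ 6])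
    fix N
    have e1: "(1/2 :: real) ^ e \<le> 1" by (simp add: power_le_one)
    \<comment> \<open>Fibonacci numbers at least double every two levels, and a letter
      \<open>b\<close> takes one level, so \<open>2 * e\<close> letters gain the factor
      \<open>2 ^ e\<close>.\<close>
    have "x \<in> S (2 * e)" using assms(2) that by simp
    then consider (a) "infinite {p. \<exists>l\<ge>2*e. a_chain_at (locating_chain x) p l}"
      | (b) "infinite {p. \<exists>l\<ge>2*e. b_chain_at (locating_chain x) p l}"
      unfolding S_def by blast
    then show "\<exists>n\<ge>N. \<exists>j q. j < q \<and> matches x j q n \<and>
      real q \<le> (golden_slope\<^sup>2 + (1/2) ^ e) * real n + 6"
    proof cases
      case a
      then obtain p l where pl: "N \<le> p" "2 * e \<le> l" "a_chain_at (locating_chain x) p l"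
        unfolding infinite_nat_iff_unbounded_le by blast
      then have ch: "\<And>i. i < 2 * l \<Longrightarrow> symb (level x (p + 1 + i)) \<noteq> Case_ii"
        and ii: "symb (level x (p + 1 + 2 * l)) = Case_ii"
        unfolding a_chain_at_iff[OF g] by auto
      define k where "k = p + 1 + 2 * l"
      have "offset x k = offset x (p + 1)" unfolding k_def by (rule offset_no_Case_ii_run[OF ch])
      also have "\<dots> \<le> fib (p + 3)" using offset_le[OF g, of "p + 1"] fib_mono[of "p + 2" "p + 3"]
        by (auto simp: numeral_3_eq_3 split: if_splits)
      finally have o: "offset x k \<le> fib (p + 3)" .
      have "2 ^ e * fib (p + 3) \<le> fib (p + 3 + 2 * e)" by (rule power2_fib_le)
      also have "\<dots> \<le> fib (k + 3)" by (rule fib_mono) (use pl k_def in linarith)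
      finally have "2 ^ e * offset x k \<le> fib (k + 3)" using mult_le_mono2[OF o, of "2 ^ e"] by linarith
      then have "real (2 ^ e * offset x k) \<le> real (fib (k + 3))" by (simp only: of_nat_le_iff)
      then have o2: "real (offset x k) \<le> (1/2) ^ e * real (fib (k + 3))"
        by (simp add: power_one_over field_simps)
      define n where "n = fib (k + 3) - 2"
      have kf: "k + 2 \<le> fib (k + 3)" using le_fib_Suc[of "k + 2"] by (simp add: numeral_3_eq_3)
      then have n: "real (fib (k + 3)) = real n + 2" "N \<le> n" using pl(1) unfolding n_def k_def by linarith+
      have "k + 3 = k + 1 + 2" by simp
      then have "real (fib (k + 1)) \<le> golden_slope\<^sup>2 * real (fib (k + 3)) + 2"
        using fib_approx2[of "k + 1"] by (simp only: abs_le_iff) linarith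
      then have "real (offset x k + fib (k + 1)) \<le> (golden_slope\<^sup>2 + (1/2) ^ e) * real (fib (k + 3)) + 2"
        using o2 by (simp add: distrib_right del: fib.simps)
      also have "\<dots> \<le> (golden_slope\<^sup>2 + (1/2) ^ e) * real n + 6"
      proof -
        have "A * (real n + 2) + 2 \<le> A * real n + 6" if "A \<le> 2" for A :: real
          using that by (simp add: distrib_left)
        then show ?thesis unfolding n(1) using e1 golden_slope_power_le_1[of 2] by simp
      qed
      finally have "real (offset x k + fib (k + 1)) \<le> (golden_slope\<^sup>2 + (1/2) ^ e) * real n + 6" .
      moreover have "matches x (offset x k) (offset x k + fib (k + 1)) n"
        unfolding n_def by (rule match_Case_ii[OF g ii[folded k_def]])
      moreover have "0 < fib (k + 1)" by (rule fib_neq_0_nat) simp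
      then have "offset x k < offset x k + fib (k + 1)" by linarith
      ultimately show ?thesis using n(2) by blast
    next
      case b
      then obtain p l where pl: "N \<le> p" "2 * e \<le> l" "b_chain_at (locating_chain x) p l"
        unfolding infinite_nat_iff_unbounded_le by blast
      then have ch: "\<And>i. i < l \<Longrightarrow> symb (level x (p + 2 + i)) = Case_ii"
        and i: "symb (level x (p + 2 + l)) = Case_i"
        unfolding b_chain_at_iff[OF g] by auto
      define k where "k = p + 2 + l"
      have iii: "symb (level x (Suc k)) = Case_iii" using i symb_level_Suc[OF g] k_def by simp
      have "p + 2 + 2 = p + 4" by simp
      then have "offset x k + fib (p + 4) = offset x (p + 2) + fib (k + 2)"
        using offset_Case_ii_run[where m = "p + 2" and l = l and x = x, OF ch] unfolding k_def by metis
      moreover have "offset x (Suc k) = offset x k" using i unfolding offset_Suc k_def by simp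
      \<comment> \<open>Only \<open>fib (p + 4)\<close> letters, at most, are missing from a full
        block, and the (i) behind the chain does not change \<open>W\<close>.\<close>
      ultimately have o: "fib (k + 2) \<le> offset x (Suc k) + fib (p + 4)" by linarith
      have "2 ^ e * fib (p + 4) \<le> fib (p + 4 + 2 * e)" by (rule power2_fib_le)
      also have "\<dots> \<le> fib (k + 2)" by (rule fib_mono) (use pl k_def in linarith)
      finally have "real (2 ^ e * fib (p + 4)) \<le> real (fib (k + 2))" by (simp only: of_nat_le_iff)
      then have o2: "real (fib (p + 4)) \<le> (1/2) ^ e * real (fib (k + 2))"
        by (simp add: power_one_over field_simps del: fib.simps)
      define n where "n = offset x (Suc k) + fib (k + 3) - 2"
      have kf: "k + 2 \<le> fib (k + 3)" using le_fib_Suc[of "k + 2"] by (simp add: numeral_3_eq_3)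
      then have n: "real n = real (offset x (Suc k)) + real (fib (k + 3)) - 2" "N \<le> n"
        using pl(1) unfolding n_def k_def by linarith+
      have "k + 2 + 2 = k + 4" "k + 2 + 1 = k + 3" by simp_all
      then have f4: "fib (k + 4) = fib (k + 3) + fib (k + 2)" using fib_plus_2[of "k + 2"] by metis
      have "real (fib (k + 2)) \<le> golden_slope\<^sup>2 * real (fib (k + 4)) + 2"
        using fib_approx2[of "k + 2"] unfolding \<open>k + 2 + 2 = k + 4\<close> abs_le_iff by linarith
      also have "golden_slope\<^sup>2 * real (fib (k + 4)) \<le> golden_slope\<^sup>2 * (real n + 2 + real (fib (p + 4)))"
        by (rule mult_left_mono) (use n(1) f4 o in linarith, simp)
      also have "\<dots> \<le> golden_slope\<^sup>2 * real n + 1 * (2 + real (fib (p + 4)))"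
        unfolding distrib_left add.assoc using golden_slope_power_le_1[of 2]
        by (intro add_left_mono add_mono mult_right_mono) auto
      finally have q: "real (fib (k + 2)) \<le> golden_slope\<^sup>2 * real n + 4 + real (fib (p + 4))" by simp
      have "fib (k + 2) \<le> fib (k + 3)" by (rule fib_mono) simp
      then have "real (fib (k + 2)) \<le> real n + 2" using n(1) by linarith
      then have "(1/2) ^ e * real (fib (k + 2)) \<le> (1/2) ^ e * (real n + 2)" by (rule mult_left_mono) simp
      then have "real (fib (p + 4)) \<le> (1/2) ^ e * real n + 2"
        using o2 e1 unfolding distrib_left by linarith
      then have "real (fib (k + 2)) \<le> (golden_slope\<^sup>2 + (1/2) ^ e) * real n + 6"
        using q unfolding distrib_right by linarith
      moreover have "matches x 0 (fib (k + 2)) n" unfolding n_def by (rule match_Case_iii[OF g iii])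
      moreover have "0 < fib (k + 2)" by (rule fib_neq_0_nat) simp
      ultimately show ?thesis using n(2) by blast
    qed
  qed
  show ?thesis
  proof (rule ereal_le_epsilon2)
    fix \<epsilon> :: real assume "0 < \<epsilon>"
    then obtain e where e: "(1/2) ^ e < \<epsilon>" using real_arch_pow_inv[of \<epsilon> "1/2"] by auto
    have "(1/2 :: real) ^ Suc e \<le> (1/2) ^ e" by simp
    then have "1 + (golden_slope\<^sup>2 + (1/2) ^ Suc e) \<le> mu_min + \<epsilon>" using e unfolding mu_min_def by linarith
    then show "rep x \<le> ereal mu_min + ereal \<epsilon>"
      using order_trans[OF *[of "Suc e"], of "ereal (mu_min + \<epsilon>)"] by simp
  qed
qed

text \<open>Between consecutive (ii) the symbols alternate, starting with (i). The last one is not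
  (i), as that would make the symbol at \<open>k\<close> a (iii). The gap therefore consists of
  whole blocks \<open>a\<close>.\<close>

lemma gap_between_Case_ii:
  assumes g: "golden x" and p: "symb (level x p) = Case_ii" "symb (level x k) = Case_ii" "p < k"
    and between: "\<And>i. p < i \<Longrightarrow> i < k \<Longrightarrow> symb (level x i) \<noteq> Case_ii"
    and no_chain: "\<And>l. d \<le> l \<Longrightarrow> \<not> a_chain_at (locating_chain x) p l" and "1 \<le> d"
  shows "k \<le> p + 2 * d"
proof -
  have alt: "symb (level x (p + 1 + i)) = (if even i then Case_i else Case_iii)" if "p + 1 + i < k" for i
    using that
  proof (induction i)
    case 0
    then have "symb (level x (Suc p)) \<noteq> Case_ii" using between by simp
    moreover have "symb (level x (Suc p)) \<noteq> Case_iii" using symb_level_Suc[OF g, of p] p(1) by simp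
    ultimately show ?case by (cases "symb (level x (Suc p))") simp_all
  next
    case (Suc i)
    then have 1: "symb (level x (p + 1 + i)) = (if even i then Case_i else Case_iii)" by simp
    have "symb (level x (p + 1 + Suc i)) \<noteq> Case_ii" using between[of "p + 1 + Suc i"] Suc.prems by simp
    moreover have "symb (level x (p + 1 + Suc i)) = Case_iii \<longleftrightarrow> even i"
      using symb_level_Suc[OF g, of "p + 1 + i"] 1 by simp
    ultimately show ?case by (cases "symb (level x (p + 1 + Suc i))") auto
  qed
  have even: "even (k - p - 1)"
  proof (rule ccontr)
    assume "odd (k - p - 1)"
    then obtain i where i: "k - p - 1 = Suc i" "even i" by (metis even_Suc odd_pos gr0_implies_Suc)
    then have "symb (level x (p + 1 + i)) = Case_i" using alt[of i] by simp
    then have "symb (level x (Suc (p + 1 + i))) = Case_iii" using symb_level_Suc[OF g] by simp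
    moreover have "Suc (p + 1 + i) = k" using i(1) p(3) by simp
    ultimately show False using p(2) by simp
  qed
  define l where "l = (k - p - 1) div 2"
  have k: "k = p + 1 + 2 * l" using even p(3) unfolding l_def by simp
  have "l < d"
  proof (cases "l = 0")
    case True
    then show ?thesis using assms(7) by simp
  next
    case False
    then have "a_chain_at (locating_chain x) p l"
      unfolding a_chain_at_iff[OF g] using alt p(1,2) k by simp
    then show ?thesis using no_chain[of l] by (meson not_le)
  qed
  then show ?thesis using k by simp
qed

lemma gap_between_Case_i:
  assumes g: "golden x" and p: "symb (level x p) = Case_i" "symb (level x k) = Case_i" "p < k"
    and between: "\<And>i. p < i \<Longrightarrow> i < k \<Longrightarrow> symb (level x i) \<noteq> Case_i"
    and no_chain: "\<And>l. d \<le> l \<Longrightarrow> \<not> b_chain_at (locating_chain x) p l" and "1 \<le> d"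
  obtains l where "l < d" "k = p + 2 + l" "\<And>i. i < l \<Longrightarrow> symb (level x (p + 2 + i)) = Case_ii"
proof -
  have "symb (level x (Suc p)) = Case_iii" using symb_level_Suc[OF g] p(1) by simp
  then have "k \<noteq> Suc p" using p(2) by auto
  then obtain l where l: "k = p + 2 + l" using p(3) by (metis Suc_leI add_2_eq_Suc' le_Suc_ex le_neq_implies_less)
  have ii: "symb (level x (p + 2 + i)) = Case_ii" if "i < l" for i
  proof -
    have "symb (level x (Suc (p + 1 + i))) \<noteq> Case_iii"
      using symb_level_Suc[OF g, of "p + 1 + i"] between[of "p + 1 + i"] that l by simp
    moreover have "symb (level x (Suc (p + 1 + i))) \<noteq> Case_i" using between that l by simp
    ultimately show ?thesis by (cases "symb (level x (p + 2 + i))") auto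
  qed
  have "l < d"
  proof (cases "l = 0")
    case True
    then show ?thesis using assms(7) by simp
  next
    case False
    then have "b_chain_at (locating_chain x) p l"
      unfolding b_chain_at_iff[OF g] using ii p(1,2) l by simp
    then show ?thesis using no_chain[of l] by (meson not_le)
  qed
  then show ?thesis using that l ii by blast
qed

lemma last_occurrence_before:
  fixes k :: nat
  assumes "P k1" "k1 < k"
  obtains p where "P p" "p < k" "k1 \<le> p" "\<And>i. p < i \<Longrightarrow> i < k \<Longrightarrow> \<not> P i"
proof -
  define A where "A = {i. i < k \<and> P i}"
  have A: "finite A" "k1 \<in> A" using assms by (simp_all add: A_def)
  then have "Max A \<in> A" by (intro Max_in) auto
  then have "P (Max A)" "Max A < k" unfolding A_def by blast+
  moreover have "k1 \<le> Max A" using A by simp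
  moreover have "\<not> P i" if "Max A < i" "i < k" for i
  proof
    assume "P i"
    then have "i \<in> A" using that(2) by (simp add: A_def)
    then show False using Max_ge[OF A(1)] that(1) by (simp add: leD)
  qed
  ultimately show ?thesis by (rule that)
qed

text \<open>With bounded chains \<open>|W|\<close> is at least a fixed fraction of
  \<open>fib (k + 3)\<close> at late (ii), and at late (iii) it stays below its maximum by such a
  fraction. Both improve the lower bound beyond \<phi>^2.\<close>

lemma rep_greater_min_if_bounded_chains:
  assumes "sturmian golden_slope x" "x \<notin> S d" "1 \<le> d"
  shows "ereal mu_min < rep x"
proof -
  have g: "golden x" using assms(1) by (rule sturmian_imp_golden)
  have "finite {p. \<exists>l\<ge>d. a_chain_at (locating_chain x) p l}"
    "finite {p. \<exists>l\<ge>d. b_chain_at (locating_chain x) p l}"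
    using assms(1,2) unfolding S_def by blast+
  then obtain Ka Kb where
    Ka: "\<And>p l. Ka < p \<Longrightarrow> d \<le> l \<Longrightarrow> \<not> a_chain_at (locating_chain x) p l" and
    Kb: "\<And>p l. Kb < p \<Longrightarrow> d \<le> l \<Longrightarrow> \<not> b_chain_at (locating_chain x) p l"
    unfolding finite_nat_set_iff_bounded_le by (metis (mono_tags, lifting) mem_Collect_eq not_le)
  have "\<exists>K. \<forall>k\<ge>K. symb (level x k) = Case_ii \<longrightarrow> fib (k + 3) \<le> 2 ^ (2 * d + 2) * offset x k"
  proof (cases "\<exists>k1>Ka. symb (level x k1) = Case_ii")
    case True
    then obtain k1 where k1: "Ka < k1" "symb (level x k1) = Case_ii" by blast
    have "fib (k + 3) \<le> 2 ^ (2 * d + 2) * offset x k" if k: "Suc k1 \<le> k" "symb (level x k) = Case_ii" for k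
    proof -
      have "k1 < k" using k(1) by simp
      then obtain p where p: "symb (level x p) = Case_ii" "p < k" "k1 \<le> p"
        "\<And>i. p < i \<Longrightarrow> i < k \<Longrightarrow> symb (level x i) \<noteq> Case_ii"
        using last_occurrence_before[of "\<lambda>i. symb (level x i) = Case_ii" k1 k, OF k1(2)] by blast
      have "Ka < p" using k1(1) p(3) by simp
      then have "k \<le> p + 2 * d"
        using gap_between_Case_ii[OF g p(1) k(2) p(2) p(4) Ka assms(3)] by blast
      then have "fib (k + 3) \<le> fib (Suc p + (2 * d + 2))" by (intro fib_mono) simp
      also have "\<dots> \<le> 2 ^ (2 * d + 2) * fib (Suc p)" by (rule fib_add_le) simp
      \<comment> \<open>The preceding (ii), at most \<open>2 * d\<close> levels back, has already
        added this length to \<open>W\<close>.\<close>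
      also have "fib (Suc p) \<le> offset x (Suc p)" unfolding offset_Suc p(1) by simp
      also have "offset x (Suc p) \<le> offset x k" using p(2) by (intro offset_mono) simp
      finally show ?thesis by simp
    qed
    then show ?thesis by blast
  next
    case False
    then show ?thesis by (intro exI[of _ "Suc Ka"]) (meson Suc_le_lessD)
  qed
  then obtain K1 where K1: "\<And>k. K1 \<le> k \<Longrightarrow> symb (level x k) = Case_ii \<Longrightarrow>
    fib (k + 3) \<le> 2 ^ (2 * d + 2) * offset x k" by blast
  have "\<exists>K. \<forall>k\<ge>K. symb (level x k) = Case_iii \<longrightarrow>
    (\<exists>D. offset x k + fib (k + 2) + D \<le> fib (k + 3) \<and> fib (k + 3) \<le> 2 ^ (2 * d + 2) * D)"
  proof (cases "\<exists>k1>Kb. symb (level x k1) = Case_i")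
    case True
    then obtain k1 where k1: "Kb < k1" "symb (level x k1) = Case_i" by blast
    have "\<exists>D. offset x k + fib (k + 2) + D \<le> fib (k + 3) \<and> fib (k + 3) \<le> 2 ^ (2 * d + 2) * D"
      if k: "k1 + 2 \<le> k" "symb (level x k) = Case_iii" for k
    proof -
      obtain h where h: "k = Suc h" using k(1) by (cases k) auto
      have hi: "symb (level x h) = Case_i" using k(2) symb_level_Suc[OF g] h by simp
      have "k1 < h" using k(1) h by simp
      then obtain p where p: "symb (level x p) = Case_i" "p < h" "k1 \<le> p"
        "\<And>i. p < i \<Longrightarrow> i < h \<Longrightarrow> symb (level x i) \<noteq> Case_i"
        using last_occurrence_before[of "\<lambda>i. symb (level x i) = Case_i" k1 h, OF k1(2)] by blast
      have "Kb < p" using k1(1) p(3) by simp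
      then obtain l where l: "l < d" "h = p + 2 + l" "\<And>i. i < l \<Longrightarrow> symb (level x (p + 2 + i)) = Case_ii"
        using gap_between_Case_i[OF g p(1) hi p(2) p(4) Kb assms(3)] by blast
      have iii: "symb (level x (Suc p)) = Case_iii" using symb_level_Suc[OF g] p(1) by simp
      have "offset x (Suc p) \<le> fib (p + 2)" using offset_le[OF g, of "Suc p"] iii by simp
      then have o1: "offset x (p + 2) \<le> fib (p + 2)" using iii offset_Suc[of x "Suc p"] by simp
      have o2: "offset x h + fib (p + 2 + 2) = offset x (p + 2) + fib (h + 2)"
        unfolding l(2) by (rule offset_Case_ii_run) (rule l(3))
      have "p + 2 + 1 = p + 3" by simp
      then have o3: "fib (p + 2 + 2) = fib (p + 3) + fib (p + 2)" using fib_plus_2[of "p + 2"] by metis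
      have "h + 2 = k + 1" using h by simp
      then have o4: "fib (h + 2) = fib (k + 1)" by metis
      have "offset x k = offset x h" unfolding h offset_Suc hi by simp
      \<comment> \<open>At the previous (iii) \<open>W\<close> had at most
        \<open>fib (p + 2)\<close> letters. The run of (ii) carries the deficit along, so
        \<open>D = fib (p + 3)\<close> letters are still missing.\<close>
      then have "offset x k + fib (p + 3) \<le> fib (k + 1)" using o1 o2 o3 o4 by linarith
      moreover have "k + 1 + 2 = k + 3" "k + 1 + 1 = k + 2" by simp_all
      then have "fib (k + 3) = fib (k + 2) + fib (k + 1)" using fib_plus_2[of "k + 1"] by metis
      ultimately have "offset x k + fib (k + 2) + fib (p + 3) \<le> fib (k + 3)" by linarith
      moreover have "fib (k + 3) \<le> fib (p + 3 + (2 * d + 2))" using h l(1,2) assms(3) by (intro fib_mono) simp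
      moreover have "fib (p + 3 + (2 * d + 2)) \<le> 2 ^ (2 * d + 2) * fib (p + 3)" by (rule fib_add_le) simp
      ultimately show ?thesis using le_trans by blast
    qed
    then show ?thesis by blast
  next
    case False
    have "symb (level x k) \<noteq> Case_iii" if kb: "Kb + 2 \<le> k" for k
    proof -
      obtain h where "k = Suc h" "Kb < h" using kb by (cases k) auto
      then show ?thesis using False symb_level_Suc[OF g] by metis
    qed
    then show ?thesis by blast
  qed
  then obtain K2 where K2: "\<And>k. K2 \<le> k \<Longrightarrow> symb (level x k) = Case_iii \<Longrightarrow>
    \<exists>D. offset x k + fib (k + 2) + D \<le> fib (k + 3) \<and> fib (k + 3) \<le> 2 ^ (2 * d + 2) * D" by blast
  define c :: real where "c = (1/2) ^ (2 * d + 2)"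
  have c: "0 < c" by (simp add: c_def)
  have "(1/2 :: real) ^ (2 * d + 2) \<le> (1/2) ^ 4" using assms(3) by (intro power_decreasing) auto
  then have c16: "c \<le> 1/16" by (simp add: c_def power4_eq_xxxx)
  have cD: "c * real F \<le> real D" if "F \<le> 2 ^ (2 * d + 2) * D" for F D
  proof -
    have "real F \<le> real (2 ^ (2 * d + 2) * D)" using that by (simp only: of_nat_le_iff)
    then show ?thesis unfolding c_def by (simp add: power_one_over field_simps)
  qed
  have lo: "golden_slope\<^sup>2 * real (fib (k + 3)) - 2 \<le> real (fib (k + 1))" for k
  proof -
    have "k + 1 + 2 = k + 3" by simp
    then show ?thesis using fib_approx2[of "k + 1"] by (metis abs_le_D2 diff_le_eq minus_diff_eq add.commute)
  qed
  have sq: "1/3 < golden_slope\<^sup>2" using golden_slope_square golden_slope_bounds by linarith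
  \<comment> \<open>The gain is only \<open>c / 4\<close> because at (iii) the factor
    \<open>1 - c\<close> must outweigh it, which works since \<phi>^2 > 1/4.\<close>
  have "ereal (1 + (golden_slope\<^sup>2 + c / 4)) \<le> rep x"
  proof (rule rep_geI_levels[OF g, where C = 2 and K = "max K1 K2"])
    show "golden_slope\<^sup>2 + c / 4 \<le> golden_slope"
      using golden_slope_square golden_slope_bounds c16 by linarith
  next
    fix k assume "max K1 K2 \<le> k" "symb (level x k) = Case_ii"
    then have "c * real (fib (k + 3)) \<le> real (offset x k)" using K1 cD by simp
    moreover have "c / 4 * real (fib (k + 3)) \<le> c * real (fib (k + 3))" using c by (intro mult_right_mono) auto
    ultimately show "(golden_slope\<^sup>2 + c / 4) * real (fib (k + 3)) - 2 \<le> real (fib (k + 1)) + real (offset x k)"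
      using lo[of k] unfolding distrib_right by linarith
  next
    fix k assume "max K1 K2 \<le> k" "symb (level x k) = Case_iii"
    then obtain D where D: "offset x k + fib (k + 2) + D \<le> fib (k + 3)" "fib (k + 3) \<le> 2 ^ (2 * d + 2) * D"
      using K2 by force
    have "real (offset x k) + real (fib (k + 2)) \<le> (1 - c) * real (fib (k + 3))"
      using D(1) cD[OF D(2)] unfolding left_diff_distrib by linarith
    then have "(golden_slope\<^sup>2 + c / 4) * (real (offset x k) + real (fib (k + 2))) \<le>
      (golden_slope\<^sup>2 + c / 4) * ((1 - c) * real (fib (k + 3)))"
      using c by (intro mult_left_mono) auto
    also have "\<dots> = ((golden_slope\<^sup>2 + c / 4) * (1 - c)) * real (fib (k + 3))" by simp
    also have "\<dots> \<le> golden_slope\<^sup>2 * real (fib (k + 3))"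
    proof (rule mult_right_mono)
      have "c * (1/4) \<le> c * golden_slope\<^sup>2" using c sq by (intro mult_left_mono) auto
      moreover have "0 \<le> c * c" by simp
      moreover have "(golden_slope\<^sup>2 + c / 4) * (1 - c) =
        golden_slope\<^sup>2 + c * (1/4) - c * golden_slope\<^sup>2 - c * c / 4"
        by (simp add: field_simps)
      ultimately show "(golden_slope\<^sup>2 + c / 4) * (1 - c) \<le> golden_slope\<^sup>2" by linarith
    qed simp
    finally show "(golden_slope\<^sup>2 + c / 4) * (real (offset x k) + real (fib (k + 2))) - 2 \<le> real (fib (k + 1))"
      using lo[of k] by linarith
  qed (use c in auto)
  moreover have "ereal mu_min < ereal (1 + (golden_slope\<^sup>2 + c / 4))" using c by (simp add: mu_min_def)
  ultimately show ?thesis by (rule less_le_trans[rotated])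
qed

section \<open>Eventually periodic locating chains\<close>

lemma cycle_block_a_nth: "cycle block_a !! n = (if even n then Case_i else Case_iii)"
proof -
  have d: "cycle block_a = Case_i ## Case_iii ## cycle block_a"
    using cycle_decomp[of block_a] by (simp add: block_a_def)
  show ?thesis
  proof (induction n rule: fib.induct)
    case (3 n)
    then show ?case by (subst d) simp
  qed (subst d, simp)+
qed

text \<open>A (iii) occurs exactly after (i), so without (ii) the symbols alternate. The prefix
  \<open>u\<close> is cut just before some (i), and it also absorbs a (iii) at the very start of the
  chain.\<close>

lemma ultimately_cycle_block_a_iff:
  assumes "golden x"
  shows "(\<exists>u. locating_chain x = u @- cycle block_a) \<longleftrightarrow> (\<exists>K. \<forall>k\<ge>K. symb (level x k) \<noteq> Case_ii)"
proof
  assume "\<exists>u. locating_chain x = u @- cycle block_a"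
  then obtain u where u: "locating_chain x = u @- cycle block_a" by blast
  have "symb (level x k) \<noteq> Case_ii" if "length u \<le> k" for k
    using that unfolding locating_chain_nth[OF assms, symmetric] u by (simp add: cycle_block_a_nth)
  then show "\<exists>K. \<forall>k\<ge>K. symb (level x k) \<noteq> Case_ii" by blast
next
  assume "\<exists>K. \<forall>k\<ge>K. symb (level x k) \<noteq> Case_ii"
  then obtain K where K: "\<And>k. K \<le> k \<Longrightarrow> symb (level x k) \<noteq> Case_ii" by blast
  have "\<exists>K'\<ge>K. symb (level x K') = Case_i"
  proof (cases "symb (level x K)")
    case Case_iii
    then have "symb (level x (Suc K)) \<noteq> Case_iii" using symb_level_Suc[OF assms] by simp
    then have "symb (level x (Suc K)) = Case_i" using K[of "Suc K"] by (cases "symb (level x (Suc K))") auto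
    then show ?thesis by (meson le_SucI order_refl)
  qed (use K in auto)
  then obtain K' where K': "K \<le> K'" "symb (level x K') = Case_i" by blast
  have s: "symb (level x (K' + i)) = (if even i then Case_i else Case_iii)" for i
  proof (induction i)
    case 0 then show ?case using K' by simp
  next
    case (Suc i)
    have "symb (level x (Suc (K' + i))) \<noteq> Case_ii" using K[of "Suc (K' + i)"] K'(1) by simp
    then show ?case using Suc symb_level_Suc[OF assms, of "K' + i"]
      by (cases "symb (level x (Suc (K' + i)))") (auto split: if_splits)
  qed
  have "sdrop K' (locating_chain x) !! i = cycle block_a !! i" for i
    by (simp add: sdrop_snth locating_chain_nth[OF assms] s cycle_block_a_nth)
  then have "sdrop K' (locating_chain x) = cycle block_a" by (metis stream_smap_nats ext)
  then show "\<exists>u. locating_chain x = u @- cycle block_a" by (metis stake_sdrop)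
qed

lemma ultimately_cycle_block_b_iff:
  assumes "golden x"
  shows "(\<exists>v. locating_chain x = v @- cycle block_b) \<longleftrightarrow> (\<exists>K. \<forall>k\<ge>K. symb (level x k) = Case_ii)"
proof -
  have cyc: "cycle block_b !! n = Case_ii" for n
    by (simp add: block_b_def flip: sconst_cycle)
  show ?thesis
  proof
    assume "\<exists>u. locating_chain x = u @- cycle block_b"
    then obtain u where u: "locating_chain x = u @- cycle block_b" by blast
    have "symb (level x k) = Case_ii" if "length u \<le> k" for k
      using that unfolding locating_chain_nth[OF assms, symmetric] u by (simp add: cyc)
    then show "\<exists>K. \<forall>k\<ge>K. symb (level x k) = Case_ii" by blast
  next
    assume "\<exists>K. \<forall>k\<ge>K. symb (level x k) = Case_ii"
    then obtain K where K: "\<And>k. K \<le> k \<Longrightarrow> symb (level x k) = Case_ii" by blast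
    have "sdrop K (locating_chain x) !! i = cycle block_b !! i" for i
      by (simp add: sdrop_snth locating_chain_nth[OF assms] K cyc)
    then have "sdrop K (locating_chain x) = cycle block_b" by (metis stream_smap_nats ext)
    then show "\<exists>v. locating_chain x = v @- cycle block_b" by (metis stake_sdrop)
  qed
qed

theorem theorem1p4:
  fixes x :: "int stream"
  assumes "sturmian golden_slope x"
  shows "ereal mu_min \<le> rep x \<and> rep x \<le> ereal mu_max \<and>
    (rep x = ereal mu_max \<longleftrightarrow>
      (\<exists>u. locating_chain x = u @- cycle block_a) \<or>
      (\<exists>v. locating_chain x = v @- cycle block_b)) \<and>
    (rep x = ereal mu_min \<longleftrightarrow> (\<forall>d\<ge>1. x \<in> S d))"
proof -
  have g: "golden x" using assms by (rule sturmian_imp_golden)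
  have lo: "ereal mu_min \<le> rep x" and hi: "rep x \<le> ereal mu_max"
    using rep_ge_min[OF g] rep_le_max[OF g] by blast+
  have "rep x = ereal mu_max \<longleftrightarrow>
    (\<exists>K. \<forall>k\<ge>K. symb (level x k) \<noteq> Case_ii) \<or> (\<exists>K. \<forall>k\<ge>K. symb (level x k) = Case_ii)"
  proof
    assume "rep x = ereal mu_max"
    then have "\<not> rep x < ereal mu_max" by simp
    then show "(\<exists>K. \<forall>k\<ge>K. symb (level x k) \<noteq> Case_ii) \<or> (\<exists>K. \<forall>k\<ge>K. symb (level x k) = Case_ii)"
      using rep_less_max_if_mixed[OF g] by blast
  next
    assume "(\<exists>K. \<forall>k\<ge>K. symb (level x k) \<noteq> Case_ii) \<or> (\<exists>K. \<forall>k\<ge>K. symb (level x k) = Case_ii)"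
    then have "ereal mu_max \<le> rep x"
      using rep_eq_max_if_ultimately_no_Case_ii[OF g] rep_eq_max_if_ultimately_Case_ii[OF g] by blast
    then show "rep x = ereal mu_max" using hi by (rule antisym[rotated])
  qed
  moreover have "rep x = ereal mu_min \<longleftrightarrow> (\<forall>d\<ge>1. x \<in> S d)"
  proof
    assume "rep x = ereal mu_min"
    then have "\<not> ereal mu_min < rep x" by simp
    then show "\<forall>d\<ge>1. x \<in> S d" using rep_greater_min_if_bounded_chains[OF assms] by blast
  next
    assume "\<forall>d\<ge>1. x \<in> S d"
    from rep_le_min_if_long_chains[OF assms this] lo show "rep x = ereal mu_min" by (rule antisym)
  qed
  ultimately show ?thesis
    unfolding ultimately_cycle_block_a_iff[OF g] ultimately_cycle_block_b_iff[OF g] using lo hi by blast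
qed

end
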